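(* Let $k\in\{0,1,2,\dots\}$, let $I\subseteq\mathbb{R}$ be an interval, and let $T\colon C^k(I)\to C(I)$ be an additive operator. Consider the conditions: (a) $T(f^2)=2f\cdot T(f)$ for all $f\in C^k(I)$; (b) $T(f\cdot g)=f\cdot T(g)+g\cdot T(f)$ for all $f,g\in C^k(I)$; (c) $T(f^n)=nf^{n-1}\cdot T(f)$ for all $f\in C^k(I)$ and all $n\in\mathbb{N}$; and, in the case when $I$ is compact, additionally the conditions: (d) $T(f\cdot g)=f\cdot T(g)+g\cdot T(f)$ for all $f,g\in C^k(I)$ with $f>0$, $g>0$; (e) $T(f^2)=2f\cdot T(f)$ for all $f\in C^k(I)$ with $f>0$; (f) $T(f)=-f^2\cdot T\left(\frac1f\right)$ for all $f\in C^k(I)$ with $f>0$; (g) $T(f^n)=nf^{n-1}\cdot T(f)$ for all $f\in C^k(I)$ with $f>0$ and all $n\in\mathbb{N}$. If $k>0$, then each of the conditions (a)--(c) (and, if $I$ is compact, each of the conditions (a)--(g)) is equivalent to the following one: (x) there exists some $d\in C(I)$ such that $T(f)=d\cdot f'$ for all $f\in C^k(I)$. If $k=0$, then $T=0$ is the only additive operator that fulfils any of the equivalent conditions (a)--(c) (respectively, if $I$ is compact, any of the equivalent conditions (a)--(g)).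
   Context: $\mathbb{N}=\{1,2,\dots\}$. For an interval $I\subseteq\mathbb{R}$ and $k\in\{0,1,2,\dots\}$, $C^k(I)$ is the space of real-valued functions on $I$ that are $k$-times continuously differentiable on the interior of $I$; if $k=0$, one writes simply $C(I)$. The space $C^k(I)$ is furnished with the standard pointwise algebraic operations and is hence a real commutative algebra. An operator $T$ is additive if $T(f+g)=T(f)+T(g)$ for all $f,g$ in its domain. Inequalities such as $f>0$ are understood pointwise on $I$, and $f'$ denotes the derivative of $f$.
   Formalization: Functions in C^k(I) and C(I) are also required to be continuous on all of I, endpoints included, and I must have nonempty interior; otherwise a nonzero derivation of the reals applied to the value at an endpoint is a counterexample. *)

theory Defs
  imports "HOL-Analysis.Analysis"
begin

text \<open>
  Functions on \<open>I\<close> are represented by the functions in \<^term>\<open>extensional I\<close>, so that HOL equality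
  is equality of functions on \<open>I\<close>; all pointwise operations are restricted to \<open>I\<close>.

  The members of \<open>Ck k I\<close> are required to be continuous on all of \<open>I\<close>, and \<open>k\<close> times continuously
  differentiable on the interior only. Without continuity at the endpoints belonging to \<open>I\<close>,
  \<open>Ck 0 I\<close> would not be the space of continuous functions on \<open>I\<close>.
\<close>

definition Ck :: "nat \<Rightarrow> real set \<Rightarrow> (real \<Rightarrow> real) set" where
  "Ck k I = {f \<in> extensional I. continuous_on I f
      \<and> (\<forall>j<k. \<forall>x\<in>interior I. (deriv ^^ j) f field_differentiable at x)
      \<and> continuous_on (interior I) ((deriv ^^ k) f)}"

lemma Ck_0: "Ck 0 I = {f \<in> extensional I. continuous_on I f}"
  using continuous_on_subset[OF _ interior_subset] by (auto simp: Ck_def)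

definition Ck_pos :: "nat \<Rightarrow> real set \<Rightarrow> (real \<Rightarrow> real) set" where
  "Ck_pos k I = {f \<in> Ck k I. \<forall>x\<in>I. f x > 0}"

definition additive_operator ::
    "nat \<Rightarrow> real set \<Rightarrow> ((real \<Rightarrow> real) \<Rightarrow> real \<Rightarrow> real) \<Rightarrow> bool" where
  "additive_operator k I T \<longleftrightarrow> T \<in> Ck k I \<rightarrow> Ck 0 I \<and>
     (\<forall>f\<in>Ck k I. \<forall>g\<in>Ck k I. T (\<lambda>x\<in>I. f x + g x) = (\<lambda>x\<in>I. T f x + T g x))"

definition square_rule ::
    "(real \<Rightarrow> real) set \<Rightarrow> real set \<Rightarrow> ((real \<Rightarrow> real) \<Rightarrow> real \<Rightarrow> real) \<Rightarrow> bool" where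
  "square_rule F I T \<longleftrightarrow> (\<forall>f\<in>F. T (\<lambda>x\<in>I. (f x)\<^sup>2) = (\<lambda>x\<in>I. 2 * f x * T f x))"

definition product_rule ::
    "(real \<Rightarrow> real) set \<Rightarrow> real set \<Rightarrow> ((real \<Rightarrow> real) \<Rightarrow> real \<Rightarrow> real) \<Rightarrow> bool" where
  "product_rule F I T \<longleftrightarrow>
     (\<forall>f\<in>F. \<forall>g\<in>F. T (\<lambda>x\<in>I. f x * g x) = (\<lambda>x\<in>I. f x * T g x + g x * T f x))"

definition power_rule ::
    "(real \<Rightarrow> real) set \<Rightarrow> real set \<Rightarrow> ((real \<Rightarrow> real) \<Rightarrow> real \<Rightarrow> real) \<Rightarrow> bool" where
  "power_rule F I T \<longleftrightarrow>
     (\<forall>f\<in>F. \<forall>n\<ge>1. T (\<lambda>x\<in>I. f x ^ n) = (\<lambda>x\<in>I. real n * f x ^ (n - 1) * T f x))"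

definition reciprocal_rule ::
    "(real \<Rightarrow> real) set \<Rightarrow> real set \<Rightarrow> ((real \<Rightarrow> real) \<Rightarrow> real \<Rightarrow> real) \<Rightarrow> bool" where
  "reciprocal_rule F I T \<longleftrightarrow>
     (\<forall>f\<in>F. T f = (\<lambda>x\<in>I. - (f x)\<^sup>2 * T (\<lambda>x\<in>I. 1 / f x) x))"

text \<open>
  \<open>T f = d \<cdot> f'\<close>. A member of \<open>Ck k I\<close> need not be differentiable at an endpoint of \<open>I\<close>, so the
  identity is required wherever the derivative relative to \<open>I\<close> exists: at all interior points if
  \<open>k > 0\<close>, and with one-sided derivatives at those endpoints where they exist. Since \<open>T f\<close> is
  continuous on \<open>I\<close>, it is determined by its values on the interior.
\<close>

definition multiple_of_derivative ::
    "nat \<Rightarrow> real set \<Rightarrow> ((real \<Rightarrow> real) \<Rightarrow> real \<Rightarrow> real) \<Rightarrow> bool" where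
  "multiple_of_derivative k I T \<longleftrightarrow> (\<exists>d\<in>Ck 0 I. \<forall>f\<in>Ck k I. \<forall>x\<in>I. \<forall>D.
     (f has_real_derivative D) (at x within I) \<longrightarrow> T f x = d x * D)"

definition zero_operator ::
    "nat \<Rightarrow> real set \<Rightarrow> ((real \<Rightarrow> real) \<Rightarrow> real \<Rightarrow> real) \<Rightarrow> bool" where
  "zero_operator k I T \<longleftrightarrow> (\<forall>f\<in>Ck k I. T f = (\<lambda>x\<in>I. 0))"

end

theory Submission
  imports Defs
begin

text \<open>
  The algebraic conditions all reduce to the product rule: polarisation passes from the square rule to
  the product rule, the identity \<open>1 / f = 1 / (f * (f + 1)) + 1 / (f + 1)\<close> from the reciprocal rule to
  the square rule, and on a compact interval adding a large integer constant, which \<open>T\<close> annihilates,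
  makes any function positive.

  An additive \<open>T\<close> with the product rule is local, since a function vanishing near \<open>y\<close> has a vanishing
  product with a bump at \<open>y\<close>. If all derivatives of \<open>f\<close> up to order \<open>k\<close> vanish at an interior point
  \<open>y\<close>, then replacing \<open>f\<close> by \<open>0\<close> to the left of \<open>y\<close> gives a function in the space, and continuity of
  its image forces \<open>T f y = 0\<close>. So \<open>T f y\<close> depends only on the Taylor polynomial of \<open>f\<close> at \<open>y\<close>, whose
  terms of degree at least two are annihilated at \<open>y\<close> by the product rule. As \<open>T\<close> is not assumed to be
  linear, it remains to exclude that it restricts to a nonzero derivation of the reals on constants.
  Such a derivation is unbounded on small constants, so a rapidly converging sum of disjoint bumps
  with suitable coefficients would have a discontinuous image.
\<close>

subsection \<open>Continuously differentiable functions on open sets\<close>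

text \<open>The interior half of \<open>Ck\<close>, without extensionality and without the condition
  at the endpoints. On an open \<open>S\<close> the values outside \<open>S\<close> do not matter,
  so unrestricted terms such as \<open>\<lambda>x. f x * g x\<close> can be treated
  directly.\<close>

definition Ck_on :: "nat \<Rightarrow> real set \<Rightarrow> (real \<Rightarrow> real) \<Rightarrow> bool" where
  "Ck_on k S f \<longleftrightarrow> (\<forall>j<k. \<forall>x\<in>S. (deriv ^^ j) f field_differentiable at x)
      \<and> continuous_on S ((deriv ^^ k) f)"

lemma Ck_eq: "Ck k I = {f \<in> extensional I. continuous_on I f \<and> Ck_on k (interior I) f}"
  by (auto simp: Ck_def Ck_on_def)

lemma Ck_on_0: "Ck_on 0 S f \<longleftrightarrow> continuous_on S f"
  by (simp add: Ck_on_def)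

text \<open>Peeling off the innermost derivative instead of the outermost gives a recursion in
  \<open>k\<close>, on which most of the inductions below run.\<close>

lemma Ck_on_Suc:
  "Ck_on (Suc k) S f \<longleftrightarrow> (\<forall>x\<in>S. f field_differentiable at x) \<and> Ck_on k S (deriv f)"
  by (simp only: Ck_on_def All_less_Suc2 funpow_Suc_right o_apply funpow_0 conj_assoc)

lemma higher_deriv_cong:
  assumes "open S" "\<And>x. x \<in> S \<Longrightarrow> f x = g x" "x \<in> S"
  shows "(deriv ^^ j) f x = (deriv ^^ j) (g :: real \<Rightarrow> real) x"
  using assms(3)
proof (induction j arbitrary: x)
  case (Suc j)
  have "eventually (\<lambda>y. (deriv ^^ j) f y = (deriv ^^ j) g y) (nhds x)"
    using Suc assms(1) by (auto simp: eventually_nhds)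
  then show ?case by (simp add: deriv_cong_ev)
qed (use assms in auto)

lemma Ck_on_cong:
  assumes "open S" "\<And>x. x \<in> S \<Longrightarrow> f x = g x"
  shows "Ck_on k S f \<longleftrightarrow> Ck_on k S g"
proof -
  have *: "Ck_on k S v" if "Ck_on k S u" "\<And>x. x \<in> S \<Longrightarrow> u x = v x" for u v
  proof -
    note eq = higher_deriv_cong[OF assms(1) that(2)]
    have "(deriv ^^ j) v field_differentiable at x" if jx: "j < k" "x \<in> S" for j x
    proof -
      obtain D where "((deriv ^^ j) u has_field_derivative D) (at x)"
        using jx \<open>Ck_on k S u\<close> unfolding Ck_on_def field_differentiable_def by blast
      then have "((deriv ^^ j) v has_field_derivative D) (at x)"
        by (rule has_field_derivative_transform_within_open[OF _ assms(1) jx(2)]) (rule eq)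
      then show ?thesis by (auto simp: field_differentiable_def)
    qed
    moreover have "continuous_on S ((deriv ^^ k) v)"
      using that(1) eq by (simp add: Ck_on_def cong: continuous_on_cong)
    ultimately show ?thesis by (auto simp: Ck_on_def)
  qed
  show ?thesis using *[of f g] *[of g f] assms(2) by auto
qed

text \<open>Any \<open>f'\<close> that is the derivative on \<open>S\<close> will do; its values off
  \<open>S\<close> may differ from those of \<open>deriv f\<close>.\<close>

lemma Ck_on_SucI:
  assumes "open S" "\<And>x. x \<in> S \<Longrightarrow> (f has_real_derivative f' x) (at x)" "Ck_on k S f'"
  shows "Ck_on (Suc k) S f"
proof -
  have "Ck_on k S (deriv f)"
    using assms DERIV_imp_deriv by (subst Ck_on_cong[where g = f']) auto
  then show ?thesis
    using assms(2) by (auto simp: Ck_on_Suc field_differentiable_def)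
qed

lemma Ck_on_SucD:
  assumes "Ck_on (Suc k) S f"
  shows "x \<in> S \<Longrightarrow> (f has_real_derivative deriv f x) (at x)" "Ck_on k S (deriv f)"
  using assms DERIV_deriv_iff_field_differentiable by (auto simp: Ck_on_Suc)

lemma Ck_on_continuous: "open S \<Longrightarrow> Ck_on k S f \<Longrightarrow> continuous_on S f"
  by (cases k) (auto simp: Ck_on_0 Ck_on_Suc field_differentiable_imp_continuous_at
      continuous_at_imp_continuous_on)

lemma Ck_on_Suc_imp: "open S \<Longrightarrow> Ck_on (Suc k) S f \<Longrightarrow> Ck_on k S f"
proof (induction k arbitrary: f)
  case 0
  then show ?case using Ck_on_continuous by (simp add: Ck_on_0)
qed (simp add: Ck_on_Suc)

lemma Ck_on_subset: "Ck_on k S f \<Longrightarrow> U \<subseteq> S \<Longrightarrow> Ck_on k U f"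
  using continuous_on_subset by (auto simp: Ck_on_def)

lemma Ck_on_const: "open S \<Longrightarrow> Ck_on k S (\<lambda>x. c)"
proof (induction k arbitrary: c)
  case (Suc k)
  then show ?case by (auto intro: Ck_on_SucI[where f' = "\<lambda>x. 0"])
qed (simp add: Ck_on_0)

lemma Ck_on_ident: "open S \<Longrightarrow> Ck_on k S (\<lambda>x. x)"
  by (cases k) (auto simp: Ck_on_0 Ck_on_const intro: Ck_on_SucI[where f' = "\<lambda>x. 1"])

lemma Ck_on_add:
  "open S \<Longrightarrow> Ck_on k S f \<Longrightarrow> Ck_on k S g \<Longrightarrow> Ck_on k S (\<lambda>x. f x + g x)"
proof (induction k arbitrary: f g)
  case (Suc k)
  show ?case
  proof (rule Ck_on_SucI[OF Suc.prems(1)])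
    show "Ck_on k S (\<lambda>x. deriv f x + deriv g x)"
      by (intro Suc.IH Ck_on_SucD(2) Suc.prems)
    show "((\<lambda>x. f x + g x) has_real_derivative deriv f x + deriv g x) (at x)" if "x \<in> S" for x
      using Ck_on_SucD(1)[OF Suc.prems(2) that] Ck_on_SucD(1)[OF Suc.prems(3) that]
      by (rule DERIV_add)
  qed
qed (simp add: Ck_on_0 continuous_on_add)

lemma Ck_on_mult:
  "open S \<Longrightarrow> Ck_on k S f \<Longrightarrow> Ck_on k S g \<Longrightarrow> Ck_on k S (\<lambda>x. f x * g x)"
proof (induction k arbitrary: f g)
  case (Suc k)
  show ?case
  proof (rule Ck_on_SucI[OF Suc.prems(1)])
    show "Ck_on k S (\<lambda>x. deriv f x * g x + deriv g x * f x)"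
      using Suc.prems Suc.prems(2,3)[THEN Ck_on_SucD(2)] Suc.prems(2,3)[THEN Ck_on_Suc_imp[OF Suc.prems(1)]]
      by (intro Ck_on_add Suc.IH)
    show "((\<lambda>x. f x * g x) has_real_derivative deriv f x * g x + deriv g x * f x) (at x)" if "x \<in> S" for x
      using Ck_on_SucD(1)[OF Suc.prems(2) that] Ck_on_SucD(1)[OF Suc.prems(3) that]
      by (rule DERIV_mult)
  qed
qed (simp add: Ck_on_0 continuous_on_mult)

lemma Ck_on_power:
  "open S \<Longrightarrow> Ck_on k S f \<Longrightarrow> Ck_on k S (\<lambda>x. f x ^ n)"
  by (induction n) (auto intro: Ck_on_const Ck_on_mult)

text \<open>The derivative \<open>- f' / f^2\<close> contains only \<open>f'\<close> and
  \<open>1 / f\<close>, and the latter is of class \<open>k\<close> by the induction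
  hypothesis.\<close>

lemma Ck_on_inverse:
  assumes "open S" "\<And>x. x \<in> S \<Longrightarrow> f x \<noteq> 0"
  shows "Ck_on k S f \<Longrightarrow> Ck_on k S (\<lambda>x. inverse (f x))"
proof (induction k)
  case 0
  then show ?case using assms by (auto simp: Ck_on_0 intro: continuous_on_inverse)
next
  case (Suc k)
  have "Ck_on k S (\<lambda>x. (-1) * (inverse (f x) * deriv f x * inverse (f x)))"
    using Suc assms(1) by (intro Ck_on_mult Ck_on_const) (auto dest: Ck_on_SucD Ck_on_Suc_imp)
  moreover have "((\<lambda>x. inverse (f x)) has_real_derivative
      (-1) * (inverse (f x) * deriv f x * inverse (f x))) (at x)" if "x \<in> S" for x
    using DERIV_inverse'[OF Ck_on_SucD(1)[OF Suc.prems that] assms(2)[OF that]] by simp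
  ultimately show ?case using assms(1) by (intro Ck_on_SucI)
qed

lemma Ck_on_sum:
  "open S \<Longrightarrow> (\<And>i. i \<in> A \<Longrightarrow> Ck_on k S (f i)) \<Longrightarrow> Ck_on k S (\<lambda>x. \<Sum>i\<in>A. f i x)"
  by (induction A rule: infinite_finite_induct) (auto intro: Ck_on_const Ck_on_add)

section \<open>Cutting off at a point, bump functions, and series\<close>

lemma DERIV_glue:
  fixes f :: "real \<Rightarrow> real"
  assumes f: "(f has_real_derivative D) (at t)" and y: "t = y \<Longrightarrow> f y = 0 \<and> D = 0"
  shows "((\<lambda>x. if x \<ge> y then f x else 0) has_real_derivative (if t \<ge> y then D else 0)) (at t)"
proof -
  consider "t > y" | "t < y" | "t = y" by linarith
  then show ?thesis
  proof cases
    case 1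
    then show ?thesis
      using has_field_derivative_transform_within_open[OF f, of "{y<..}"] by auto
  next
    case 2
    have "((\<lambda>x. if x \<ge> y then f x else 0) has_real_derivative 0) (at t)"
    proof (rule has_field_derivative_transform_within_open)
      show "((\<lambda>x. 0) has_real_derivative 0) (at t)" by simp
      show "open {..<y}" "t \<in> {..<y}" using 2 by auto
    qed auto
    then show ?thesis using 2 by simp
  next
    case 3
    \<comment> \<open>At the cut itself, the difference quotient of the cut-off function is
      dominated by that of \<open>f\<close>, which tends to 0.\<close>
    then have "((\<lambda>x. (f x - f t) / (x - t)) \<longlongrightarrow> 0) (at t)"
      using f y by (auto simp: has_field_derivative_iff)
    then have "((\<lambda>x. ((if x \<ge> y then f x else 0) - f t) / (x - t)) \<longlongrightarrow> 0) (at t)"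
      by (rule Lim_null_comparison[rotated, OF tendsto_norm_zero]) (use 3 y in auto)
    then show ?thesis using 3 y by (auto simp: has_field_derivative_iff)
  qed
qed

text \<open>Cutting off commutes with differentiation as long as function and derivative vanish at
  \<open>y\<close>, so the induction passes from \<open>f\<close> to \<open>deriv f\<close>, whose
  derivatives at \<open>y\<close> are those of \<open>f\<close> shifted by one order.\<close>

lemma Ck_on_glue:
  assumes "open S" "y \<in> S" "Ck_on k S f" "\<And>j. j \<le> k \<Longrightarrow> (deriv ^^ j) f y = 0"
  shows "Ck_on k S (\<lambda>x. if x \<ge> y then f x else 0)"
  using assms(3,4)
proof (induction k arbitrary: f)
  case 0
  then have f: "continuous_on S f" "f y = 0" by (auto simp: Ck_on_0)
  have "continuous_on S (\<lambda>x. f (max x y))"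
    using assms(2) by (intro continuous_on_compose2[OF f(1)] continuous_intros) (auto simp: max_def)
  moreover have "(if x \<ge> y then f x else 0) = f (max x y)" for x
    using f(2) by (auto simp: max_def)
  ultimately show ?case by (simp add: Ck_on_0)
next
  case (Suc k)
  note d = Ck_on_SucD[OF Suc.prems(1)]
  have 0: "f y = 0" "deriv f y = 0" using Suc.prems(2)[of 0] Suc.prems(2)[of 1] by auto
  show ?case
  proof (rule Ck_on_SucI[OF assms(1)])
    show "((\<lambda>x. if x \<ge> y then f x else 0) has_real_derivative (if x \<ge> y then deriv f x else 0)) (at x)"
      if "x \<in> S" for x
      by (rule DERIV_glue[OF d(1)[OF that]]) (use 0 in auto)
    show "Ck_on k S (\<lambda>x. if x \<ge> y then deriv f x else 0)"
      using d(2) Suc.prems(2)[of "Suc _"]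
      by (intro Suc.IH) (auto simp: funpow_swap1)
  qed
qed

text \<open>The derivative of such a power has the same shape with exponent one less. The factor
  \<open>c\<close> is general because it absorbs the exponent and the slope
  \<open>a\<close>.\<close>

lemma Ck_on_pos_part_power: "Ck_on k UNIV (\<lambda>x. c * max 0 (a * x + b) ^ Suc k)"
proof (induction k arbitrary: c)
  case 0
  then show ?case by (auto simp: Ck_on_0 intro!: continuous_intros)
next
  case (Suc k)
  show ?case
  proof (rule Ck_on_SucI[OF open_UNIV])
    show "Ck_on k UNIV (\<lambda>x. (c * (real (Suc (Suc k)) * a)) * max 0 (a * x + b) ^ Suc k)"
      by (rule Suc)
    fix x
    let ?n = "Suc (Suc k)"
    have "((\<lambda>u. if u \<ge> 0 then u ^ ?n else 0) has_real_derivative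
        (if a * x + b \<ge> 0 then real ?n * (a * x + b) ^ Suc k else 0)) (at (a * x + b))"
      by (rule DERIV_glue) (use DERIV_pow[of ?n "a * x + b"] in simp_all)
    moreover have "((\<lambda>x. a * x + b) has_real_derivative a) (at x)"
      by (auto intro!: derivative_eq_intros)
    ultimately have "((\<lambda>x. if a * x + b \<ge> 0 then (a * x + b) ^ ?n else 0) has_real_derivative
        (if a * x + b \<ge> 0 then real ?n * (a * x + b) ^ Suc k else 0) * a) (at x)"
      by (rule DERIV_chain2)
    then have 3: "((\<lambda>x. c * (if a * x + b \<ge> 0 then (a * x + b) ^ ?n else 0)) has_real_derivative
        c * ((if a * x + b \<ge> 0 then real ?n * (a * x + b) ^ Suc k else 0) * a)) (at x)"
      by (rule DERIV_cmult)
    have 1: "(if u \<ge> 0 then u ^ ?n else 0) = max 0 u ^ ?n" for u :: real by auto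
    have 2: "c * ((if a * x + b \<ge> 0 then real ?n * (a * x + b) ^ Suc k else 0) * a)
        = (c * (real ?n * a)) * max 0 (a * x + b) ^ Suc k" by auto
    show "((\<lambda>x. c * max 0 (a * x + b) ^ ?n) has_real_derivative
        (c * (real ?n * a)) * max 0 (a * x + b) ^ Suc k) (at x)"
      using 3 by (simp only: 1 2)
  qed
qed

lemma Ck_bump_exists:
  obtains g where "Ck_on k UNIV g" "\<And>x. a < x \<Longrightarrow> x < b \<Longrightarrow> g x > 0"
    "\<And>x. x \<le> a \<or> b \<le> x \<Longrightarrow> g x = 0"
proof
  \<comment> \<open>Product of powers of the positive parts of \<open>x - a\<close> and
    \<open>b - x\<close>. The factors 1 and -1 make both instances of
    \<open>Ck_on_pos_part_power\<close>.\<close>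
  let ?g = "\<lambda>x. (1 * max 0 (1 * x + - a) ^ Suc k) * (1 * max 0 ((-1) * x + b) ^ Suc k)"
  show "Ck_on k UNIV ?g" by (intro Ck_on_mult Ck_on_pos_part_power open_UNIV)
qed auto

lemma Ck_on_continuous_higher_deriv:
  "open S \<Longrightarrow> Ck_on k S f \<Longrightarrow> j \<le> k \<Longrightarrow> continuous_on S ((deriv ^^ j) f)"
  by (cases "j = k") (auto simp: Ck_on_def field_differentiable_imp_continuous_at
      continuous_at_imp_continuous_on)

text \<open>Derivatives are continuous on the compact interval and vanish on its open complement.
  One positive bound serves all orders, so that it can be divided by when the coefficients of a
  series are chosen.\<close>

lemma Ck_on_compact_support_bounded:
  assumes "Ck_on k UNIV g" "\<And>x. x \<notin> {a..b} \<Longrightarrow> g x = 0"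
  obtains M where "M > 0" "\<And>j x. j \<le> k \<Longrightarrow> \<bar>(deriv ^^ j) g x\<bar> \<le> M"
proof -
  have "\<exists>M. \<forall>x. \<bar>(deriv ^^ j) g x\<bar> \<le> M" if "j \<le> k" for j
  proof -
    have "compact ((deriv ^^ j) g ` {a..b})"
      using Ck_on_continuous_higher_deriv[OF open_UNIV assms(1) that]
      by (intro compact_continuous_image) (auto intro: continuous_on_subset)
    then obtain M where M: "\<And>x. x \<in> {a..b} \<Longrightarrow> \<bar>(deriv ^^ j) g x\<bar> \<le> M"
      by (meson bounded_real compact_imp_bounded imageI)
    have "(deriv ^^ j) (\<lambda>x. 0 :: real) = (\<lambda>x. 0)" by (induction j) auto
    then have "(deriv ^^ j) g x = 0" if "x \<notin> {a..b}" for x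
      using higher_deriv_cong[of "- {a..b}" g "\<lambda>x. 0" x j] assms(2) that by auto
    then have "\<bar>(deriv ^^ j) g x\<bar> \<le> max 0 M" for x
      using M[of x] by (cases "x \<in> {a..b}") auto
    then show ?thesis by auto
  qed
  then obtain M where M: "\<And>j x. j \<le> k \<Longrightarrow> \<bar>(deriv ^^ j) g x\<bar> \<le> M j" by metis
  have "\<bar>(deriv ^^ j) g x\<bar> \<le> 1 + (\<Sum>j\<le>k. \<bar>M j\<bar>)" if "j \<le> k" for j x
    using M[OF that, of x] member_le_sum[of j "{..k}" "\<lambda>j. \<bar>M j\<bar>"] that by force
  moreover have "1 + (\<Sum>j\<le>k. \<bar>M j\<bar>) > 0" by (simp add: add_pos_nonneg sum_nonneg)
  ultimately show ?thesis using that by blast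
qed

text \<open>Weierstrass M-test and termwise differentiation. Since \<open>M\<close> does not depend
  on the order \<open>j\<close>, the hypotheses pass to the series of derivatives.\<close>

lemma Ck_on_suminf:
  assumes "\<And>n. Ck_on k UNIV (\<phi> n)" "summable M"
    "\<And>n j x. j \<le> k \<Longrightarrow> \<bar>(deriv ^^ j) (\<phi> n) x\<bar> \<le> M n"
  shows "Ck_on k UNIV (\<lambda>x. \<Sum>n. \<phi> n x)"
  using assms(1,3)
proof (induction k arbitrary: \<phi>)
  case 0
  have "uniform_limit UNIV (\<lambda>n x. \<Sum>i<n. \<phi> i x) (\<lambda>x. \<Sum>n. \<phi> n x) sequentially"
    using 0(2)[of 0] assms(2) by (intro Weierstrass_m_test) auto
  moreover have "\<forall>\<^sub>F n in sequentially. continuous_on UNIV (\<lambda>x. \<Sum>i<n. \<phi> i x)"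
    using 0(1) by (intro always_eventually allI continuous_on_sum) (simp add: Ck_on_0)
  ultimately have "continuous_on UNIV (\<lambda>x. \<Sum>n. \<phi> n x)"
    by (intro uniform_limit_theorem) auto
  then show ?case by (simp only: Ck_on_0)
next
  case (Suc k)
  have M0: "norm (\<phi> n x) \<le> M n" for n x using Suc.prems(2)[of 0] by auto
  have M1: "norm (deriv (\<phi> n) x) \<le> M n" for n x using Suc.prems(2)[of 1] by auto
  note d = Ck_on_SucD[OF Suc.prems(1)]
  show ?case
  proof (rule Ck_on_SucI[OF open_UNIV])
    fix x :: real
    show "((\<lambda>x. \<Sum>n. \<phi> n x) has_real_derivative (\<Sum>n. deriv (\<phi> n) x)) (at x)"
    proof (rule has_field_derivative_series'(2)[of UNIV \<phi> "\<lambda>n. deriv (\<phi> n)" x])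
      show "uniformly_convergent_on UNIV (\<lambda>n x. \<Sum>i<n. deriv (\<phi> i) x)"
        using M1 assms(2) by (rule Weierstrass_m_test')
      show "summable (\<lambda>n. \<phi> n x)"
        using assms(2) M0 by (rule summable_comparison_test'[where N = 0])
    qed (simp_all add: d(1))
    show "Ck_on k UNIV (\<lambda>x. \<Sum>n. deriv (\<phi> n) x)"
      using d(2) Suc.prems(2)[of "Suc _"] by (intro Suc.IH) (auto simp: funpow_swap1)
  qed
qed

section \<open>Taylor polynomials\<close>

definition jet_poly :: "(nat \<Rightarrow> real) \<Rightarrow> nat \<Rightarrow> real \<Rightarrow> real \<Rightarrow> real" where
  "jet_poly a n y x = (\<Sum>j<n. a j / fact j * (x - y) ^ j)"

text \<open>With the factorials in place, differentiation is just a shift of the sequence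
  \<open>a\<close>; this is why \<open>a\<close> is an arbitrary sequence and not the derivatives of
  a given function.\<close>

lemma DERIV_jet_poly:
  "(jet_poly a (Suc n) y has_real_derivative jet_poly (\<lambda>j. a (Suc j)) n y x) (at x)"
proof -
  have "((\<lambda>x. a (Suc j) / fact (Suc j) * (x - y) ^ Suc j) has_real_derivative
      a (Suc j) / fact (Suc j) * (real (Suc j) * (x - y) ^ j)) (at x)" for j
  proof (rule DERIV_cmult)
    show "((\<lambda>x. (x - y) ^ Suc j) has_real_derivative real (Suc j) * (x - y) ^ j) (at x)"
    proof -
      have "((\<lambda>x. x - y) has_real_derivative 1) (at x)"
        by (auto intro!: derivative_eq_intros)
      from DERIV_power[OF this, of "Suc j"] show ?thesis by simp
    qed
  qed
  then have "((\<lambda>x. a 0 + (\<Sum>j<n. a (Suc j) / fact (Suc j) * (x - y) ^ Suc j)) has_real_derivative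
      0 + (\<Sum>j<n. a (Suc j) / fact (Suc j) * (real (Suc j) * (x - y) ^ j))) (at x)"
    by (intro DERIV_add DERIV_const DERIV_sum)
  moreover have "jet_poly a (Suc n) y
      = (\<lambda>x. a 0 + (\<Sum>j<n. a (Suc j) / fact (Suc j) * (x - y) ^ Suc j))"
    unfolding jet_poly_def sum.lessThan_Suc_shift by auto
  moreover have "a (Suc j) / fact (Suc j) * (real (Suc j) * (x - y) ^ j)
      = a (Suc j) / fact j * (x - y) ^ j" for j
    by (simp add: field_simps del: of_nat_Suc)
  ultimately show ?thesis by (simp add: jet_poly_def)
qed

lemma higher_deriv_jet_poly: "i < n \<Longrightarrow> (deriv ^^ i) (jet_poly a n y) y = a i"
proof (induction i arbitrary: a n)
  case 0
  then obtain m where "n = Suc m" by (cases n) auto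
  then show ?case unfolding jet_poly_def sum.lessThan_Suc_shift by simp
next
  case (Suc i)
  then obtain m where m: "n = Suc m" by (cases n) auto
  have "deriv (jet_poly a n y) = jet_poly (\<lambda>j. a (Suc j)) m y"
    unfolding m using DERIV_jet_poly DERIV_imp_deriv by blast
  then show ?case using Suc m by (simp add: funpow_swap1)
qed

text \<open>\<open>deriv\<close> respects differences only where both functions are differentiable,
  so the available class \<open>k\<close> decreases together with \<open>j\<close> in the
  induction.\<close>

lemma higher_deriv_diff:
  assumes "open S" "Ck_on k S f" "Ck_on k S g" "j \<le> k" "x \<in> S"
  shows "(deriv ^^ j) (\<lambda>x. f x - g x) x = (deriv ^^ j) f x - (deriv ^^ j) g x"
  using assms(2-)
proof (induction j arbitrary: k f g)
  case (Suc j)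
  then obtain k' where k: "k = Suc k'" by (cases k) auto
  note f = Ck_on_SucD[OF Suc.prems(1)[unfolded k]] and g = Ck_on_SucD[OF Suc.prems(2)[unfolded k]]
  have "deriv (\<lambda>x. f x - g x) x = deriv f x - deriv g x" if "x \<in> S" for x
    using f(1) g(1) that by (intro DERIV_imp_deriv DERIV_diff) auto
  then have "(deriv ^^ j) (deriv (\<lambda>x. f x - g x)) x = (deriv ^^ j) (\<lambda>x. deriv f x - deriv g x) x"
    using Suc.prems assms(1) by (intro higher_deriv_cong) auto
  also have "\<dots> = (deriv ^^ j) (deriv f) x - (deriv ^^ j) (deriv g) x"
    using Suc.prems k f(2) g(2) by (intro Suc.IH[of k']) auto
  finally show ?case by (simp add: funpow_swap1)
qed auto

lemma higher_deriv_cmult: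
  assumes "open S" "Ck_on k S f" "j \<le> k" "x \<in> S"
  shows "(deriv ^^ j) (\<lambda>x. c * f x) x = c * (deriv ^^ j) f x"
  using assms(2-)
proof (induction j arbitrary: k f)
  case (Suc j)
  then obtain k' where k: "k = Suc k'" by (cases k) auto
  note f = Ck_on_SucD[OF Suc.prems(1)[unfolded k]]
  have "deriv (\<lambda>x. c * f x) x = c * deriv f x" if "x \<in> S" for x
    using f(1) that by (intro DERIV_imp_deriv DERIV_cmult) auto
  then have "(deriv ^^ j) (deriv (\<lambda>x. c * f x)) x = (deriv ^^ j) (\<lambda>x. c * deriv f x) x"
    using Suc.prems assms(1) by (intro higher_deriv_cong) auto
  also have "\<dots> = c * (deriv ^^ j) (deriv f) x"
    using Suc.prems k f(2) by (intro Suc.IH[of k']) auto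
  finally show ?case by (simp add: funpow_swap1)
qed auto

lemma Ck_on_jet_poly: "Ck_on k UNIV (jet_poly a n y)"
proof -
  have "Ck_on k UNIV (\<lambda>x. x + - y)" by (intro Ck_on_add Ck_on_ident Ck_on_const open_UNIV)
  then have "Ck_on k UNIV (\<lambda>x. \<Sum>j<n. a j / fact j * (x + - y) ^ j)"
    by (intro Ck_on_sum Ck_on_mult Ck_on_const Ck_on_power open_UNIV)
  then show ?thesis by (simp add: jet_poly_def[abs_def])
qed

subsection \<open>Equivalence of the algebraic conditions\<close>

text \<open>A nonempty interior excludes one-point intervals, on which a nonzero derivation of the
  field of reals would satisfy the product rule without being zero.\<close>

locale additive_on_Ck =
  fixes k :: nat and I :: "real set" and T :: "(real \<Rightarrow> real) \<Rightarrow> real \<Rightarrow> real"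
  assumes interval: "is_interval I" and interior: "interior I \<noteq> {}"
    and additive: "additive_operator k I T"
begin

text \<open>\<open>A\<close> and \<open>D\<close> replace \<^term>\<open>Ck k I\<close> and \<open>T\<close> by a space of functions without the
  restriction to \<open>I\<close> and the operator on it; values outside \<open>I\<close> are irrelevant.\<close>

definition A :: "(real \<Rightarrow> real) set" where
  "A = {f. continuous_on I f \<and> Ck_on k (interior I) f}"

definition A_pos :: "(real \<Rightarrow> real) set" where
  "A_pos = {f \<in> A. \<forall>x\<in>I. f x > 0}"

definition D :: "(real \<Rightarrow> real) \<Rightarrow> real \<Rightarrow> real" where
  "D f = T (restrict f I)"

lemma A_pos_subset: "A_pos \<subseteq> A"
  by (auto simp: A_pos_def)

lemma restrict_in_Ck: "f \<in> A \<Longrightarrow> restrict f I \<in> Ck k I"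
  using Ck_on_cong[OF open_interior, of I "restrict f I" f] interior_subset[of I]
  by (auto simp: A_def Ck_eq subset_iff cong: continuous_on_cong)

lemma Ck_in_A: "f \<in> Ck k I \<Longrightarrow> f \<in> A"
  by (auto simp: A_def Ck_eq)

lemma D_Ck: "f \<in> Ck k I \<Longrightarrow> D f = T f"
  by (auto simp: D_def Ck_def extensional_restrict)

text \<open>As an image, \<open>Ck k I\<close> allows \<open>ball_simps\<close> to turn quantifiers
  over it into quantifiers over \<open>A\<close>.\<close>

lemma Ck_eq_image: "Ck k I = (\<lambda>f. restrict f I) ` A"
proof -
  have "f \<in> (\<lambda>f. restrict f I) ` A" if "f \<in> Ck k I" for f
    using that Ck_in_A[OF that] by (intro image_eqI[of _ _ f]) (auto simp: Ck_def extensional_restrict)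
  then show ?thesis using restrict_in_Ck by auto
qed

lemma Ck_pos_eq_image: "Ck_pos k I = (\<lambda>f. restrict f I) ` A_pos"
  unfolding Ck_pos_def A_pos_def Ck_eq_image by auto

lemma T_restrict: "f \<in> A \<Longrightarrow> T (restrict f I) = restrict (D f) I"
  using additive restrict_in_Ck
  by (auto simp: additive_operator_def D_def Ck_def Pi_iff extensional_restrict)

lemma continuous_on_D: "f \<in> A \<Longrightarrow> continuous_on I (D f)"
  using additive restrict_in_Ck by (auto simp: additive_operator_def D_def Ck_def Pi_iff)

lemma D_cong: "(\<And>x. x \<in> I \<Longrightarrow> f x = g x) \<Longrightarrow> D f = D g"
  unfolding D_def by (metis restrict_ext)

lemma A_const: "(\<lambda>x. c) \<in> A"
  by (simp add: A_def Ck_on_const)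

lemma A_ident: "(\<lambda>x. x) \<in> A"
  by (simp add: A_def Ck_on_ident)

lemma A_add: "f \<in> A \<Longrightarrow> g \<in> A \<Longrightarrow> (\<lambda>x. f x + g x) \<in> A"
  by (simp add: A_def Ck_on_add continuous_on_add)

lemma A_mult: "f \<in> A \<Longrightarrow> g \<in> A \<Longrightarrow> (\<lambda>x. f x * g x) \<in> A"
  by (simp add: A_def Ck_on_mult continuous_on_mult)

lemma A_power: "f \<in> A \<Longrightarrow> (\<lambda>x. f x ^ n) \<in> A"
  by (simp add: A_def Ck_on_power continuous_on_power)

lemma A_diff: "f \<in> A \<Longrightarrow> g \<in> A \<Longrightarrow> (\<lambda>x. f x - g x) \<in> A"
  using A_add[OF _ A_mult[OF A_const[of "-1"]], of f g] by simp

lemma A_pos_inverse: "f \<in> A_pos \<Longrightarrow> (\<lambda>x. 1 / f x) \<in> A"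
  using Ck_on_inverse[OF open_interior, of I f k] continuous_on_inverse[of I f] interior_subset[of I]
  by (fastforce simp: A_def A_pos_def inverse_eq_divide)

lemma A_if_Ck_on_UNIV: "Ck_on k UNIV f \<Longrightarrow> f \<in> A"
  unfolding A_def
  by (blast intro: Ck_on_subset continuous_on_subset[OF Ck_on_continuous[OF open_UNIV]])

lemma A_pos_const: "c > 0 \<Longrightarrow> (\<lambda>x. c) \<in> A_pos"
  by (simp add: A_pos_def A_const)

lemma A_pos_add: "f \<in> A_pos \<Longrightarrow> g \<in> A_pos \<Longrightarrow> (\<lambda>x. f x + g x) \<in> A_pos"
  by (simp add: A_pos_def A_add add_pos_pos)

lemma A_pos_mult: "f \<in> A_pos \<Longrightarrow> g \<in> A_pos \<Longrightarrow> (\<lambda>x. f x * g x) \<in> A_pos"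
  by (simp add: A_pos_def A_mult)

lemma D_add: "f \<in> A \<Longrightarrow> g \<in> A \<Longrightarrow> y \<in> I \<Longrightarrow> D (\<lambda>x. f x + g x) y = D f y + D g y"
proof -
  assume *: "f \<in> A" "g \<in> A" "y \<in> I"
  have "T (\<lambda>x\<in>I. restrict f I x + restrict g I x)
      = (\<lambda>x\<in>I. T (restrict f I) x + T (restrict g I) x)"
    using additive restrict_in_Ck[OF *(1)] restrict_in_Ck[OF *(2)]
    unfolding additive_operator_def by blast
  moreover have "(\<lambda>x\<in>I. restrict f I x + restrict g I x) = (\<lambda>x\<in>I. f x + g x)"
    by (auto simp: restrict_def)
  ultimately show ?thesis using * by (simp add: D_def)
qed

lemma D_zero: "y \<in> I \<Longrightarrow> D (\<lambda>x. 0) y = 0"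
  using D_add[OF A_const A_const, of y 0 0] by simp

lemma D_diff: "f \<in> A \<Longrightarrow> g \<in> A \<Longrightarrow> y \<in> I \<Longrightarrow> D (\<lambda>x. f x - g x) y = D f y - D g y"
  using D_add[OF A_diff, of f g g y] by simp

text \<open>Additivity alone yields homogeneity for natural factors; \<open>T\<close> is not assumed
  to commute with real ones.\<close>

lemma D_of_nat_mult: "f \<in> A \<Longrightarrow> y \<in> I \<Longrightarrow> D (\<lambda>x. of_nat n * f x) y = of_nat n * D f y"
proof (induction n)
  case (Suc n)
  then have "D (\<lambda>x. of_nat n * f x + f x) y = of_nat n * D f y + D f y"
    using A_mult[OF A_const] by (subst D_add) auto
  then show ?case by (simp add: algebra_simps)
qed (simp add: D_zero)

section \<open>The rules as pointwise identities for \<open>D\<close>\<close>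

lemma restrict_eq_restrict_iff:
  "restrict u I = restrict v I \<longleftrightarrow> (\<forall>x\<in>I. u x = v x)"
  by (auto simp: fun_eq_iff)

text \<open>Both sides of the rule are restrictions to \<open>I\<close>, so their equality is
  pointwise equality on \<open>I\<close>. The set \<open>B\<close> will be \<open>A\<close> or
  \<open>A_pos\<close>, here and in the next two lemmas.\<close>

lemma square_rule_iff:
  assumes "B \<subseteq> A"
  shows "square_rule ((\<lambda>f. restrict f I) ` B) I T
    \<longleftrightarrow> (\<forall>f\<in>B. \<forall>y\<in>I. D (\<lambda>x. (f x)\<^sup>2) y = 2 * f y * D f y)"
  unfolding square_rule_def ball_simps
proof (intro ball_cong refl)
  fix f assume "f \<in> B"
  have "(\<lambda>x\<in>I. (restrict f I x)\<^sup>2) = (\<lambda>x\<in>I. (f x)\<^sup>2)" by auto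
  then have "T (\<lambda>x\<in>I. (restrict f I x)\<^sup>2) = restrict (D (\<lambda>x. (f x)\<^sup>2)) I"
    using T_restrict[OF A_power] \<open>f \<in> B\<close> assms by auto
  then show "T (\<lambda>x\<in>I. (restrict f I x)\<^sup>2) = (\<lambda>x\<in>I. 2 * restrict f I x * T (restrict f I) x)
      \<longleftrightarrow> (\<forall>y\<in>I. D (\<lambda>x. (f x)\<^sup>2) y = 2 * f y * D f y)"
    by (simp add: restrict_eq_restrict_iff flip: D_def)
qed

lemma product_rule_iff:
  assumes "B \<subseteq> A"
  shows "product_rule ((\<lambda>f. restrict f I) ` B) I T
    \<longleftrightarrow> (\<forall>f\<in>B. \<forall>g\<in>B. \<forall>y\<in>I. D (\<lambda>x. f x * g x) y = f y * D g y + g y * D f y)"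
  unfolding product_rule_def ball_simps
proof (intro ball_cong refl)
  fix f g assume "f \<in> B" "g \<in> B"
  have "(\<lambda>x\<in>I. restrict f I x * restrict g I x) = (\<lambda>x\<in>I. f x * g x)" by auto
  then have "T (\<lambda>x\<in>I. restrict f I x * restrict g I x) = restrict (D (\<lambda>x. f x * g x)) I"
    using T_restrict[OF A_mult] \<open>f \<in> B\<close> \<open>g \<in> B\<close> assms by auto
  then show "T (\<lambda>x\<in>I. restrict f I x * restrict g I x)
        = (\<lambda>x\<in>I. restrict f I x * T (restrict g I) x + restrict g I x * T (restrict f I) x)
      \<longleftrightarrow> (\<forall>y\<in>I. D (\<lambda>x. f x * g x) y = f y * D g y + g y * D f y)"
    by (simp add: restrict_eq_restrict_iff flip: D_def)
qed

lemma power_rule_iff: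
  assumes "B \<subseteq> A"
  shows "power_rule ((\<lambda>f. restrict f I) ` B) I T
    \<longleftrightarrow> (\<forall>f\<in>B. \<forall>n\<ge>1. \<forall>y\<in>I. D (\<lambda>x. f x ^ n) y = real n * f y ^ (n - 1) * D f y)"
  unfolding power_rule_def ball_simps
proof (intro ball_cong all_cong refl)
  fix f and n :: nat assume "f \<in> B"
  have "(\<lambda>x\<in>I. restrict f I x ^ n) = (\<lambda>x\<in>I. f x ^ n)" by auto
  then have "T (\<lambda>x\<in>I. restrict f I x ^ n) = restrict (D (\<lambda>x. f x ^ n)) I"
    using T_restrict[OF A_power] \<open>f \<in> B\<close> assms by auto
  then show "T (\<lambda>x\<in>I. restrict f I x ^ n)
        = (\<lambda>x\<in>I. real n * restrict f I x ^ (n - 1) * T (restrict f I) x)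
      \<longleftrightarrow> (\<forall>y\<in>I. D (\<lambda>x. f x ^ n) y = real n * f y ^ (n - 1) * D f y)"
    by (simp add: restrict_eq_restrict_iff flip: D_def)
qed

lemma reciprocal_rule_iff:
  "reciprocal_rule ((\<lambda>f. restrict f I) ` A_pos) I T
    \<longleftrightarrow> (\<forall>f\<in>A_pos. \<forall>y\<in>I. D f y = - (f y)\<^sup>2 * D (\<lambda>x. 1 / f x) y)"
  unfolding reciprocal_rule_def ball_simps
proof (intro ball_cong refl)
  fix f assume "f \<in> A_pos"
  then have 1: "T (restrict f I) = restrict (D f) I" using A_pos_subset T_restrict by auto
  have 2: "(\<lambda>x\<in>I. 1 / restrict f I x) = (\<lambda>x\<in>I. 1 / f x)" by auto
  show "T (restrict f I) = (\<lambda>x\<in>I. - (restrict f I x)\<^sup>2 * T (\<lambda>x\<in>I. 1 / restrict f I x) x)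
      \<longleftrightarrow> (\<forall>y\<in>I. D f y = - (f y)\<^sup>2 * D (\<lambda>x. 1 / f x) y)"
    unfolding 2 D_def[symmetric] using 1[folded D_def] restrict_eq_restrict_iff[of "D f"] by simp
qed

section \<open>Implications between the rules\<close>

lemma square_imp_product:
  assumes B: "B \<subseteq> A" "\<And>f g. f \<in> B \<Longrightarrow> g \<in> B \<Longrightarrow> (\<lambda>x. f x + g x) \<in> B"
    and sq: "\<forall>f\<in>B. \<forall>y\<in>I. D (\<lambda>x. (f x)\<^sup>2) y = 2 * f y * D f y"
    and fg: "f \<in> B" "g \<in> B" "y \<in> I"
  shows "D (\<lambda>x. f x * g x) y = f y * D g y + g y * D f y"
proof -
  have A: "f \<in> A" "g \<in> A" using B fg by auto
  \<comment> \<open>Twice the product is written as a sum because \<open>D\<close> is only additive.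
    Using nothing but sums, the argument also covers \<open>A_pos\<close>, which is not closed under
    differences.\<close>
  have "D (\<lambda>x. (f x + g x)\<^sup>2) y = D (\<lambda>x. ((f x)\<^sup>2 + (g x)\<^sup>2) + (f x * g x + f x * g x)) y"
    by (simp add: power2_sum algebra_simps)
  also have "\<dots> = D (\<lambda>x. (f x)\<^sup>2) y + D (\<lambda>x. (g x)\<^sup>2) y + 2 * D (\<lambda>x. f x * g x) y"
    using A fg(3) by (simp only: D_add A_add A_mult A_power mult_2)
  finally show ?thesis
    using sq[rule_format, OF fg(1,3)] sq[rule_format, OF fg(2,3)]
      sq[rule_format, OF B(2)[OF fg(1,2)] fg(3)] D_add[OF A fg(3)]
    by (simp add: algebra_simps)
qed

lemma product_imp_power:
  assumes B: "B \<subseteq> A" "\<And>f g. f \<in> B \<Longrightarrow> g \<in> B \<Longrightarrow> (\<lambda>x. f x * g x) \<in> B"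
    and pr: "\<forall>f\<in>B. \<forall>g\<in>B. \<forall>y\<in>I. D (\<lambda>x. f x * g x) y = f y * D g y + g y * D f y"
    and f: "f \<in> B" "y \<in> I" and "n \<ge> 1"
  shows "D (\<lambda>x. f x ^ n) y = real n * f y ^ (n - 1) * D f y"
proof -
  \<comment> \<open>The induction starts at exponent 1 and carries membership in \<open>B\<close>
    along, since the product rule needs both factors there.\<close>
  have "(\<lambda>x. f x ^ Suc m) \<in> B \<and> D (\<lambda>x. f x ^ Suc m) y = real (Suc m) * f y ^ m * D f y" for m
  proof (induction m)
    case (Suc m)
    then show ?case
      using B(2)[OF f(1)] pr[rule_format, OF f(1) _ f(2)] by (fastforce simp: algebra_simps)
  qed (simp add: f)
  from this[of "n - 1"] show ?thesis using \<open>n \<ge> 1\<close> by simp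
qed

lemma power_imp_square:
  assumes "\<forall>f\<in>B. \<forall>n\<ge>1. \<forall>y\<in>I. D (\<lambda>x. f x ^ n) y = real n * f y ^ (n - 1) * D f y"
  shows "\<forall>f\<in>B. \<forall>y\<in>I. D (\<lambda>x. (f x)\<^sup>2) y = 2 * f y * D f y"
  using assms[rule_format, of _ 2] by simp

text \<open>Apply the product rule to \<open>f * (1 / f) = 1\<close> and use that \<open>D\<close>
  annihilates 1.\<close>

lemma product_imp_reciprocal:
  assumes pr: "\<forall>f\<in>A. \<forall>g\<in>A. \<forall>y\<in>I. D (\<lambda>x. f x * g x) y = f y * D g y + g y * D f y"
    and f: "f \<in> A_pos" "y \<in> I"
  shows "D f y = - (f y)\<^sup>2 * D (\<lambda>x. 1 / f x) y"
proof -
  have f0: "f x > 0" if "x \<in> I" for x using f that by (auto simp: A_pos_def)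
  have "D (\<lambda>x. 1) y = 0"
    using pr[rule_format, OF A_const[of 1] A_const[of 1] f(2)] by simp
  moreover have "D (\<lambda>x. f x * (1 / f x)) = D (\<lambda>x. 1)"
    using f0 by (intro D_cong) force
  ultimately have "f y * D (\<lambda>x. 1 / f x) y + 1 / f y * D f y = 0"
    using pr[rule_format, OF _ A_pos_inverse[OF f(1)] f(2), of f] f(1) A_pos_subset by auto
  then have "f y * (f y * D (\<lambda>x. 1 / f x) y + 1 / f y * D f y) = 0" by simp
  then show ?thesis using f0[OF f(2)] by (simp add: algebra_simps power2_eq_square)
qed

text \<open>With \<open>g = f + 1\<close>, the identity \<open>1 / f = 1 / (f * g) + 1 / g\<close>
  and three uses of the rule give \<open>D (f * g) = g^2 * D f - f^2 * D g\<close>. Here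
  \<open>D g = D f\<close> and \<open>D (f * g) = D (f^2) + D f\<close>, while
  \<open>g^2 - f^2 = 2 * f + 1\<close>.\<close>

lemma reciprocal_imp_square:
  assumes rec: "\<And>f y. f \<in> A_pos \<Longrightarrow> y \<in> I \<Longrightarrow> D f y = - (f y)\<^sup>2 * D (\<lambda>x. 1 / f x) y"
    and f: "f \<in> A_pos" and y: "y \<in> I"
  shows "D (\<lambda>x. (f x)\<^sup>2) y = 2 * f y * D f y"
proof -
  have f0: "f x > 0" if "x \<in> I" for x using f that by (auto simp: A_pos_def)
  have fA: "f \<in> A" using f A_pos_subset by auto
  define g where "g = (\<lambda>x. f x + 1)"
  have g: "g \<in> A_pos" unfolding g_def by (intro A_pos_add f A_pos_const) simp
  have h: "(\<lambda>x. f x * g x) \<in> A_pos" by (intro A_pos_mult f g)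
  \<comment> \<open>For the constant 1 the rule reads \<open>D 1 = - D 1\<close>.\<close>
  have "D (\<lambda>x. 1) y = 0" using rec[OF A_pos_const[of 1] y] by simp
  then have Dg: "D g y = D f y" using D_add[OF fA A_const y] by (simp add: g_def)
  have "D (\<lambda>x. f x * g x) y = D (\<lambda>x. (f x)\<^sup>2 + f x) y"
    by (simp add: g_def algebra_simps power2_eq_square)
  also have "\<dots> = D (\<lambda>x. (f x)\<^sup>2) y + D f y" using fA y by (intro D_add A_power)
  finally have Dh: "D (\<lambda>x. f x * g x) y = D (\<lambda>x. (f x)\<^sup>2) y + D f y" .
  have "D (\<lambda>x. 1 / f x) y = D (\<lambda>x. 1 / (f x * g x) + 1 / g x) y"
  proof (rule fun_cong[OF D_cong])
    fix x assume "x \<in> I"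
    then show "1 / f x = 1 / (f x * g x) + 1 / g x"
      using f0[of x] by (simp add: g_def divide_simps)
  qed
  also have "\<dots> = D (\<lambda>x. 1 / (f x * g x)) y + D (\<lambda>x. 1 / g x) y"
    using A_pos_inverse[OF h] A_pos_inverse[OF g] y by (rule D_add)
  finally have "D (\<lambda>x. (f x)\<^sup>2) y + D f y = (f y * g y)\<^sup>2 * (D (\<lambda>x. 1 / g x) y - D (\<lambda>x. 1 / f x) y)"
    using rec[OF h y] Dh by (simp add: algebra_simps)
  also have "\<dots> = (g y)\<^sup>2 * (- (f y)\<^sup>2 * D (\<lambda>x. 1 / f x) y) - (f y)\<^sup>2 * (- (g y)\<^sup>2 * D (\<lambda>x. 1 / g x) y)"
    by (simp add: algebra_simps power_mult_distrib)
  also have "\<dots> = (g y)\<^sup>2 * D f y - (f y)\<^sup>2 * D f y"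
    using rec[OF f y] rec[OF g y] Dg by simp
  finally show ?thesis by (simp add: g_def algebra_simps power2_eq_square)
qed

text \<open>Compactness bounds \<open>f\<close>, so \<open>f + n\<close> is positive for some
  natural \<open>n\<close>. Expanding its square and cancelling works for natural \<open>n\<close>,
  because \<open>D\<close> annihilates such constants and commutes with such factors.\<close>

lemma square_pos_imp_square:
  assumes "compact I"
    and sq: "\<And>f y. f \<in> A_pos \<Longrightarrow> y \<in> I \<Longrightarrow> D (\<lambda>x. (f x)\<^sup>2) y = 2 * f y * D f y"
    and f: "f \<in> A" and y: "y \<in> I"
  shows "D (\<lambda>x. (f x)\<^sup>2) y = 2 * f y * D f y"
proof -
  have "bounded (f ` I)"
    using assms(1) f by (intro compact_imp_bounded compact_continuous_image) (auto simp: A_def)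
  then obtain b where b: "\<And>x. x \<in> I \<Longrightarrow> \<bar>f x\<bar> \<le> b" by (meson bounded_real imageI)
  obtain n :: nat where n: "b < real n" using reals_Archimedean2 by blast
  have "f x + real n > 0" if "x \<in> I" for x using b[OF that] n by linarith
  then have g: "(\<lambda>x. f x + real n) \<in> A_pos" using f by (simp add: A_pos_def A_add A_const)
  have D1: "D (\<lambda>x. 1) y = 0" using sq[OF A_pos_const[of 1] y] by simp
  have Dn: "D (\<lambda>x. real m) y = 0" for m using D_of_nat_mult[OF A_const[of 1] y, of m] D1 by simp
  have "D (\<lambda>x. (f x + real n)\<^sup>2) y = D (\<lambda>x. ((f x)\<^sup>2 + real (2 * n) * f x) + real (n\<^sup>2)) y"
    by (simp add: power2_sum algebra_simps)
  also have "\<dots> = D (\<lambda>x. (f x)\<^sup>2) y + D (\<lambda>x. real (2 * n) * f x) y + D (\<lambda>x. real (n\<^sup>2)) y"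
    using f y by (simp only: D_add A_add A_mult A_power A_const)
  also have "\<dots> = D (\<lambda>x. (f x)\<^sup>2) y + real (2 * n) * D f y"
    by (simp only: D_of_nat_mult[OF f y] Dn)
  finally show ?thesis
    using sq[OF g y] D_add[OF f A_const y] Dn by (simp add: algebra_simps)
qed

text \<open>On \<open>A\<close>, square, product and power rule imply each other cyclically. On
  \<open>A_pos\<close>, each rule follows from the product rule on \<open>A\<close> and leads to the
  square rule on \<open>A_pos\<close>; only the return from there to \<open>A\<close> uses
  compactness.\<close>

lemma rules_equiv:
  defines "P \<equiv> product_rule (Ck k I) I T"
  shows "square_rule (Ck k I) I T \<longleftrightarrow> P" "power_rule (Ck k I) I T \<longleftrightarrow> P"
    "compact I \<Longrightarrow> product_rule (Ck_pos k I) I T \<longleftrightarrow> P"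
    "compact I \<Longrightarrow> square_rule (Ck_pos k I) I T \<longleftrightarrow> P"
    "compact I \<Longrightarrow> reciprocal_rule (Ck_pos k I) I T \<longleftrightarrow> P"
    "compact I \<Longrightarrow> power_rule (Ck_pos k I) I T \<longleftrightarrow> P"
proof -
  define Sq where "Sq B \<longleftrightarrow> (\<forall>f\<in>B. \<forall>y\<in>I. D (\<lambda>x. (f x)\<^sup>2) y = 2 * f y * D f y)" for B
  define Pr where "Pr B \<longleftrightarrow>
    (\<forall>f\<in>B. \<forall>g\<in>B. \<forall>y\<in>I. D (\<lambda>x. f x * g x) y = f y * D g y + g y * D f y)" for B
  define Pw where "Pw B \<longleftrightarrow>
    (\<forall>f\<in>B. \<forall>n\<ge>1. \<forall>y\<in>I. D (\<lambda>x. f x ^ n) y = real n * f y ^ (n - 1) * D f y)" for B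
  define Rc where "Rc \<longleftrightarrow> (\<forall>f\<in>A_pos. \<forall>y\<in>I. D f y = - (f y)\<^sup>2 * D (\<lambda>x. 1 / f x) y)"
  note iffs = square_rule_iff product_rule_iff power_rule_iff reciprocal_rule_iff
  have eqs: "P \<longleftrightarrow> Pr A" "square_rule (Ck k I) I T \<longleftrightarrow> Sq A" "power_rule (Ck k I) I T \<longleftrightarrow> Pw A"
    "product_rule (Ck_pos k I) I T \<longleftrightarrow> Pr A_pos" "square_rule (Ck_pos k I) I T \<longleftrightarrow> Sq A_pos"
    "power_rule (Ck_pos k I) I T \<longleftrightarrow> Pw A_pos" "reciprocal_rule (Ck_pos k I) I T \<longleftrightarrow> Rc"
    unfolding P_def Ck_eq_image Ck_pos_eq_image Sq_def Pr_def Pw_def Rc_def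
    using A_pos_subset by (simp_all add: iffs)
  have 1: "Sq A \<Longrightarrow> Pr A" "Sq A_pos \<Longrightarrow> Pr A_pos"
    using square_imp_product[of A] square_imp_product[of A_pos] A_pos_subset A_add A_pos_add
    unfolding Sq_def Pr_def by auto
  have 2: "Pr A \<Longrightarrow> Pw A" "Pr A_pos \<Longrightarrow> Pw A_pos"
    using product_imp_power[of A] product_imp_power[of A_pos] A_pos_subset A_mult A_pos_mult
    unfolding Pw_def Pr_def by auto
  have 3: "Pw B \<Longrightarrow> Sq B" for B
    unfolding Sq_def Pw_def by (rule power_imp_square)
  have 4: "Pr A \<Longrightarrow> Rc" "Rc \<Longrightarrow> Sq A_pos"
    using product_imp_reciprocal reciprocal_imp_square unfolding Pr_def Rc_def Sq_def by auto
  have 5: "compact I \<Longrightarrow> Sq A_pos \<Longrightarrow> Sq A"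
    using square_pos_imp_square unfolding Sq_def by auto
  have 6: "Pr A \<Longrightarrow> Pr A_pos" using A_pos_subset unfolding Pr_def by blast
  show "square_rule (Ck k I) I T \<longleftrightarrow> P" "power_rule (Ck k I) I T \<longleftrightarrow> P"
    "compact I \<Longrightarrow> product_rule (Ck_pos k I) I T \<longleftrightarrow> P"
    "compact I \<Longrightarrow> square_rule (Ck_pos k I) I T \<longleftrightarrow> P"
    "compact I \<Longrightarrow> reciprocal_rule (Ck_pos k I) I T \<longleftrightarrow> P"
    "compact I \<Longrightarrow> power_rule (Ck_pos k I) I T \<longleftrightarrow> P"
    unfolding eqs using 1 2 3 4 5 6 by blast+
qed

end

subsection \<open>Derivations\<close>

text \<open>Used with \<open>F\<close> a one-sided neighbourhood filter: a continuous function
  vanishing on one side of \<open>y\<close> vanishes at \<open>y\<close>.\<close>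

lemma isCont_eq_0_if_eventually:
  fixes u :: "real \<Rightarrow> real"
  assumes "isCont u y" "F \<le> at y" "F \<noteq> bot" "eventually (\<lambda>x. u x = 0) F"
  shows "u y = 0"
proof (rule tendsto_unique[OF assms(3)])
  show "(u \<longlongrightarrow> u y) F" using assms(1,2) by (auto simp: isCont_def intro: tendsto_mono)
  show "(u \<longlongrightarrow> 0) F" using assms(4) by (rule tendsto_eventually)
qed

context additive_on_Ck
begin

text \<open>The interior of a nondegenerate interval is dense in it, so identities between
  continuous functions extend to the endpoints.\<close>

lemma eq_on_I_if_eq_on_interior:
  fixes u v :: "real \<Rightarrow> real"
  assumes "continuous_on I u" "continuous_on I v" "\<And>x. x \<in> interior I \<Longrightarrow> u x = v x" "x \<in> I"
  shows "u x = v x"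
proof -
  have "x \<in> closure (interior I)"
    using convex_closure_interior[of I] interval interior assms(4) closure_subset
    by (auto simp: is_interval_convex)
  then obtain z where z: "\<And>n. z n \<in> interior I" "z \<longlonglongrightarrow> x"
    by (auto simp: closure_sequential)
  have "(\<lambda>n. w (z n)) \<longlonglongrightarrow> w x" if "continuous_on I w" for w :: "real \<Rightarrow> real"
    using that z assms(4) interior_subset
    by (intro continuous_on_tendsto_compose[OF that]) (auto intro!: always_eventually)
  from this[OF assms(1)] this[OF assms(2)] show ?thesis
    using assms(3) z(1) by (simp add: LIMSEQ_unique)
qed

lemma A_cont: "f \<in> A \<Longrightarrow> continuous_on I f"
  by (simp add: A_def)

lemma DERIV_A:
  "k > 0 \<Longrightarrow> f \<in> A \<Longrightarrow> x \<in> interior I \<Longrightarrow> (f has_real_derivative deriv f x) (at x)"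
  using Ck_on_SucD(1)[of "k - 1" "interior I" f x] by (simp add: A_def)

lemma isCont_D: "f \<in> A \<Longrightarrow> y \<in> interior I \<Longrightarrow> isCont (D f) y"
  using continuous_on_D by (blast intro: continuous_on_interior)

end

section \<open>Locality and Taylor expansion\<close>

locale derivation_on_Ck = additive_on_Ck +
  assumes product_rule: "product_rule (Ck k I) I T"
begin

lemma D_mult: "f \<in> A \<Longrightarrow> g \<in> A \<Longrightarrow> y \<in> I \<Longrightarrow> D (\<lambda>x. f x * g x) y = f y * D g y + g y * D f y"
  using product_rule product_rule_iff[of A] by (auto simp: Ck_eq_image)

text \<open>For a bump \<open>g\<close> at \<open>y\<close> supported in \<open>U\<close>,
  \<open>f * g = 0\<close>; as \<open>f y = 0\<close>, the product rule leaves
  \<open>g y * D f y = 0\<close> with \<open>g y > 0\<close>.\<close>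

lemma D_eq_0_if_locally_0:
  assumes "f \<in> A" "open U" "y \<in> U" "y \<in> I" "\<And>x. x \<in> U \<Longrightarrow> f x = 0"
  shows "D f y = 0"
proof -
  obtain e where e: "e > 0" "ball y e \<subseteq> U" using assms(2,3) openE by blast
  obtain g where g: "Ck_on k UNIV g" "\<And>x. y - e < x \<Longrightarrow> x < y + e \<Longrightarrow> g x > 0"
    "\<And>x. x \<le> y - e \<or> y + e \<le> x \<Longrightarrow> g x = 0"
    using Ck_bump_exists[of k "y - e" "y + e"] by metis
  have "f x * g x = 0" for x
  proof (cases "x \<le> y - e \<or> y + e \<le> x")
    case False
    then have "x \<in> ball y e" by (auto simp: dist_real_def)
    then show ?thesis using e assms(5) by auto
  qed (simp add: g(3))
  then have "(\<lambda>x. f x * g x) = (\<lambda>x. 0)" by (rule ext)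
  then have "f y * D g y + g y * D f y = 0"
    using D_mult[OF assms(1) A_if_Ck_on_UNIV[OF g(1)] assms(4)] D_zero[OF assms(4)] by simp
  then show ?thesis using g(2)[of y] e assms(3,5) by simp
qed

lemma D_local:
  assumes "f \<in> A" "g \<in> A" "open U" "y \<in> U" "y \<in> I" "\<And>x. x \<in> U \<Longrightarrow> f x = g x"
  shows "D f y = D g y"
  using D_eq_0_if_locally_0[OF A_diff[OF assms(1,2)] assms(3-5)] assms D_diff by auto

text \<open>By locality \<open>D h\<close> vanishes to the left of \<open>y\<close> and equals
  \<open>D f\<close> to the right. Continuity from each side gives \<open>D h y = 0\<close> and
  \<open>D f y = D h y\<close>.\<close>

lemma D_eq_0_if_jet_0:
  assumes f: "f \<in> A" and y: "y \<in> interior I" and jet: "\<And>j. j \<le> k \<Longrightarrow> (deriv ^^ j) f y = 0"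
  shows "D f y = 0"
proof -
  define h where "h x = (if x \<ge> y then f x else 0)" for x
  have yI: "y \<in> I" using y interior_subset by auto
  \<comment> \<open>This form gives continuity on all of \<open>I\<close>; \<open>Ck_on_glue\<close>
    speaks of the interior only.\<close>
  have "h x = f (max x y)" for x using jet[of 0] by (auto simp: h_def max_def)
  moreover have "continuous_on I (\<lambda>x. f (max x y))"
  proof (rule continuous_on_compose2[of I f])
    show "continuous_on I f" using f by (simp add: A_def)
    show "continuous_on I (\<lambda>x. max x y)" by (intro continuous_intros)
  qed (use yI in \<open>auto simp: max_def\<close>)
  ultimately have "h \<in> A"
    using Ck_on_glue[OF open_interior y _ jet] f by (simp add: A_def h_def[abs_def])
  have "D h y = 0"
  proof (rule isCont_eq_0_if_eventually[of y "D h" "at_left y"])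
    have "D h x = 0" if "x \<in> interior I" "x < y" for x
      using \<open>h \<in> A\<close> that interior_subset
      by (intro D_eq_0_if_locally_0[of h "{..<y}"]) (auto simp: h_def)
    then show "\<forall>\<^sub>F x in at_left y. D h x = 0"
      using y unfolding eventually_at_topological by (metis open_interior lessThan_iff)
  qed (use isCont_D[OF \<open>h \<in> A\<close> y] in \<open>auto intro: at_le\<close>)
  moreover have "D f y - D h y = 0"
  proof (rule isCont_eq_0_if_eventually[of y "\<lambda>x. D f x - D h x" "at_right y"])
    have "D f x = D h x" if "x \<in> interior I" "x > y" for x
      using \<open>h \<in> A\<close> f that interior_subset
      by (intro D_local[of f h "{y<..}"]) (auto simp: h_def)
    then show "\<forall>\<^sub>F x in at_right y. D f x - D h x = 0"
      using y unfolding eventually_at_topological by (metis open_interior greaterThan_iff diff_self)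
  qed (use isCont_D[OF \<open>h \<in> A\<close> y] isCont_D[OF f y] in \<open>auto intro: at_le\<close>)
  ultimately show ?thesis by simp
qed

lemma A_shift: "(\<lambda>x. x - y) \<in> A"
  by (intro A_diff A_ident A_const)

text \<open>A term of degree at least two is a product of two functions vanishing at
  \<open>y\<close>, so the product rule kills it there. The coefficients \<open>a 0\<close> and
  \<open>a 1\<close> stay inside \<open>D\<close>, which is not yet known to be linear.\<close>

lemma D_jet_poly:
  assumes "y \<in> I"
  shows "D (jet_poly a (Suc n) y) y
    = D (\<lambda>x. a 0) y + (if n = 0 then 0 else D (\<lambda>x. a 1 * (x - y)) y)"
proof (induction n)
  case 0
  show ?case by (simp add: jet_poly_def)
next
  case (Suc n)
  let ?t = "\<lambda>x. a (Suc n) / fact (Suc n) * (x - y) ^ n"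
  have t: "?t \<in> A" by (intro A_mult A_const A_power A_shift)
  have "jet_poly a (Suc (Suc n)) y = (\<lambda>x. jet_poly a (Suc n) y x + ?t x * (x - y))"
    by (simp add: jet_poly_def fun_eq_iff del: fact_Suc)
  then have "D (jet_poly a (Suc (Suc n)) y) y
      = D (jet_poly a (Suc n) y) y + D (\<lambda>x. ?t x * (x - y)) y"
    using D_add[OF A_if_Ck_on_UNIV[OF Ck_on_jet_poly] A_mult[OF t A_shift] assms] by metis
  moreover have "D (\<lambda>x. ?t x * (x - y)) y = (if n = 0 then D (\<lambda>x. a 1 * (x - y)) y else 0)"
    using D_mult[OF t A_shift[of y] assms] by auto
  ultimately show ?case using Suc by auto
qed

lemma D_eq_Taylor:
  assumes f: "f \<in> A" and y: "y \<in> interior I"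
  shows "D f y = D (\<lambda>x. f y) y + (if k = 0 then 0 else D (\<lambda>x. deriv f y * (x - y)) y)"
proof -
  define a where "a j = (deriv ^^ j) f y" for j
  \<comment> \<open>\<open>Suc k\<close> coefficients match the derivatives of orders 0 to
    \<open>k\<close>, so \<open>f - ?p\<close> satisfies \<open>D_eq_0_if_jet_0\<close>.\<close>
  let ?p = "jet_poly a (Suc k) y"
  have p: "Ck_on k UNIV ?p" by (rule Ck_on_jet_poly)
  have yI: "y \<in> I" using y interior_subset by auto
  have "D (\<lambda>x. f x - ?p x) y = 0"
  proof (rule D_eq_0_if_jet_0[OF _ y])
    fix j assume "j \<le> k"
    then show "(deriv ^^ j) (\<lambda>x. f x - ?p x) y = 0"
      using higher_deriv_diff[OF open_interior _ Ck_on_subset[OF p] _ y] f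
        higher_deriv_jet_poly[of j "Suc k" a y]
      by (simp add: A_def a_def)
  qed (intro A_diff f A_if_Ck_on_UNIV p)
  then have "D f y = D ?p y" using D_diff[OF f A_if_Ck_on_UNIV[OF p] yI] by simp
  then show ?thesis using D_jet_poly[OF yI, of a k] by (simp add: a_def)
qed

section \<open>Constants are annihilated\<close>

lemma D_one: "y \<in> I \<Longrightarrow> D (\<lambda>x. 1) y = 0"
  using D_mult[OF A_const[of 1] A_const[of 1], of y] by simp

lemma D_of_int: "y \<in> I \<Longrightarrow> D (\<lambda>x. of_int z) y = 0"
proof -
  assume y: "y \<in> I"
  have nat: "D (\<lambda>x. real n) y = 0" for n
    using D_of_nat_mult[OF A_const[of 1] y, of n] D_one[OF y] by simp
  show ?thesis
  proof (cases z rule: int_cases2)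
    case (nonpos n)
    then show ?thesis using D_diff[OF A_const[of 0] A_const y, of "real n"] nat[of n] D_zero[OF y] by simp
  qed (use nat in simp)
qed

text \<open>\<open>D\<close> is \<open>\<rat>\<close>-linear and annihilates rational constants; hence, unless it annihilates all
  constants, it is unbounded on arbitrarily small constants.\<close>

lemma D_small_const_large:
  assumes y: "y \<in> I" and c: "D (\<lambda>x. c) y \<noteq> 0" and "\<eta> > 0"
  obtains c' where "\<bar>c'\<bar> \<le> \<eta>" "\<bar>D (\<lambda>x. c') y\<bar> \<ge> K"
proof -
  obtain N where N: "K < real N * \<bar>D (\<lambda>x. c) y\<bar>"
    using c reals_Archimedean3[of "\<bar>D (\<lambda>x. c) y\<bar>"] by auto
  obtain m where m: "inverse (real (Suc m)) < \<eta>" using \<open>\<eta> > 0\<close> reals_Archimedean by blast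
  define L where "L = Suc m"
  \<comment> \<open>Dropping the integer part of \<open>L * N * c\<close> does not change its image,
    so \<open>D c' = N * D c\<close>, whereas the fractional part divided by \<open>L\<close> is at
    most \<open>1 / L\<close>.\<close>
  define c' where "c' = frac (real (L * N) * c) / real L"
  have L: "real L > 0" by (simp add: L_def)
  have "\<bar>c'\<bar> \<le> 1 / real L"
    using frac_lt_1[of "real (L * N) * c"] L by (simp add: c'_def divide_right_mono)
  then have 1: "\<bar>c'\<bar> \<le> \<eta>" using m by (simp add: L_def inverse_eq_divide)
  have "real L * c' + of_int \<lfloor>real (L * N) * c\<rfloor> = real (L * N) * c"
    using L by (simp add: c'_def frac_def)
  then have "D (\<lambda>x. real L * c' + of_int \<lfloor>real (L * N) * c\<rfloor>) y = D (\<lambda>x. real (L * N) * c) y"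
    by simp
  then have "real L * D (\<lambda>x. c') y = real (L * N) * D (\<lambda>x. c) y"
    by (simp only: D_add[OF A_const A_const y] D_of_int[OF y] D_of_nat_mult[OF A_const y] add_0_right)
  then have "D (\<lambda>x. c') y = real N * D (\<lambda>x. c) y" using L by simp
  then have "\<bar>D (\<lambda>x. c') y\<bar> \<ge> K" using N by (simp add: abs_mult)
  with 1 show ?thesis by (rule that)
qed

lemma D_const:
  assumes y: "y \<in> interior I"
  shows "D (\<lambda>x. c) y = 0"
proof (rule ccontr)
  assume nz: "D (\<lambda>x. c) y \<noteq> 0"
  \<comment> \<open>Nonvanishing is needed near \<open>y\<close>, because large images of small
    constants are required at points \<open>p n\<close> tending to \<open>y\<close>.\<close>
  have "\<forall>\<^sub>F x in at y. D (\<lambda>x. c) x \<noteq> 0"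
    using isCont_D[OF A_const y, of c] nz unfolding isCont_def by (rule tendsto_imp_eventually_ne)
  then have "\<forall>\<^sub>F x in nhds y. D (\<lambda>x. c) x \<noteq> 0"
    using nz by (simp add: eventually_nhds_conv_at)
  moreover have "\<forall>\<^sub>F x in nhds y. x \<in> I"
    using eventually_nhds_in_open[OF open_interior y] by eventually_elim (use interior_subset in auto)
  ultimately have "\<forall>\<^sub>F x in nhds y. x \<in> I \<and> D (\<lambda>x. c) x \<noteq> 0" by eventually_elim simp
  then obtain r where r: "r > 0" "\<And>x. dist x y < r \<Longrightarrow> x \<in> I \<and> D (\<lambda>x. c) x \<noteq> 0"
    unfolding eventually_nhds_metric by blast
  \<comment> \<open>The points \<open>s n\<close> decrease to \<open>y\<close> and bound disjoint
    open intervals with midpoints \<open>p n\<close>; the bump \<open>\<phi> n\<close> is supported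
    in the closure of the n-th one.\<close>
  define s where "s n = y + r / real (Suc n)" for n
  define p where "p n = (s n + s (Suc n)) / 2" for n
  have s_less: "s (Suc n) < s n" for n
    using r(1) by (simp add: s_def divide_strict_left_mono)
  then have "strict_mono (\<lambda>n. - s n)" by (simp add: strict_mono_Suc_iff)
  then have s_anti: "s n \<le> s m" if "m \<le> n" for m n
    using that monoD[OF strict_mono_mono] by fastforce
  have "y < s n" for n using r(1) by (simp add: s_def)
  have p: "s (Suc n) < p n" "p n < s n" for n using s_less[of n] by (auto simp: p_def)
  have "s \<longlonglongrightarrow> y"
    using tendsto_add[OF tendsto_const tendsto_mult[OF tendsto_const LIMSEQ_inverse_real_of_nat], of y r]
    by (simp add: s_def[abs_def] field_simps)
  then have "p \<longlonglongrightarrow> (y + y) / 2"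
    unfolding p_def using LIMSEQ_Suc by (intro tendsto_intros) auto
  then have p_lim: "p \<longlonglongrightarrow> y" by simp
  have pI: "p n \<in> I \<and> D (\<lambda>x. c) (p n) \<noteq> 0" for n
  proof (rule r(2))
    have "p n < s 0" using p(2)[of n] s_anti[of 0 n] by simp
    then show "dist (p n) y < r" using p(1)[of n] \<open>y < s (Suc n)\<close> by (simp add: dist_real_def s_def)
  qed
  have "\<exists>\<phi>. Ck_on k UNIV \<phi> \<and> \<phi> (p n) > 0 \<and> (\<forall>x. x \<le> s (Suc n) \<or> s n \<le> x \<longrightarrow> \<phi> x = 0)" for n
    using Ck_bump_exists[of k "s (Suc n)" "s n"] p[of n] by metis
  then obtain \<phi> where \<phi>: "\<And>n. Ck_on k UNIV (\<phi> n)" "\<And>n. \<phi> n (p n) > 0"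
    "\<And>n x. x \<le> s (Suc n) \<or> s n \<le> x \<Longrightarrow> \<phi> n x = 0"
    by metis
  have "\<exists>M>0. \<forall>j x. j \<le> k \<longrightarrow> \<bar>(deriv ^^ j) (\<phi> n) x\<bar> \<le> M" for n
  proof (rule Ck_on_compact_support_bounded[of k "\<phi> n" "s (Suc n)" "s n"])
    show "\<phi> n x = 0" if "x \<notin> {s (Suc n)..s n}" for x
      using \<phi>(3)[of x n] that by auto
  qed (use \<phi>(1) in blast)+
  then obtain M where M: "\<And>n. M n > 0" "\<And>n j x. j \<le> k \<Longrightarrow> \<bar>(deriv ^^ j) (\<phi> n) x\<bar> \<le> M n"
    by metis
  \<comment> \<open>The bound by \<open>(1 / 2) ^ n / M n\<close> makes the series converge with its
    derivatives, and the bound by 1 controls the term with \<open>D (\<phi> n)\<close>. The lower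
    bound makes the image of the constant outweigh that term by \<open>n\<close>.\<close>
  have "\<exists>c. \<bar>c\<bar> \<le> min 1 ((1 / 2) ^ n / M n) \<and>
      \<bar>D (\<lambda>x. c) (p n)\<bar> \<ge> (real n + \<bar>D (\<phi> n) (p n)\<bar>) / \<phi> n (p n)" for n
  proof (rule D_small_const_large[of "p n" c "min 1 ((1 / 2) ^ n / M n)"])
    show "0 < min 1 ((1 / 2) ^ n / M n)" using M(1) by simp
  qed (use pI in auto)
  then obtain d where d: "\<And>n. \<bar>d n\<bar> \<le> min 1 ((1 / 2) ^ n / M n)"
    "\<And>n. \<bar>D (\<lambda>x. d n) (p n)\<bar> \<ge> (real n + \<bar>D (\<phi> n) (p n)\<bar>) / \<phi> n (p n)"
    by metis
  define F where "F x = (\<Sum>n. d n * \<phi> n x)" for x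
  have "Ck_on k UNIV F"
    unfolding F_def
  proof (rule Ck_on_suminf)
    show "Ck_on k UNIV (\<lambda>x. d n * \<phi> n x)" for n
      by (intro Ck_on_mult Ck_on_const \<phi>(1) open_UNIV)
    show "summable (\<lambda>n. (1 / 2 :: real) ^ n)" by simp
    fix n j x assume j: "j \<le> k"
    have "\<bar>d n\<bar> * \<bar>(deriv ^^ j) (\<phi> n) x\<bar> \<le> (1 / 2) ^ n / M n * M n"
      using d(1)[of n] M(1)[of n] M(2)[OF j, of n x] by (intro mult_mono) auto
    then show "\<bar>(deriv ^^ j) (\<lambda>x. d n * \<phi> n x) x\<bar> \<le> (1 / 2) ^ n"
      using higher_deriv_cmult[OF open_UNIV \<phi>(1) j] M(1)[of n] by (simp add: abs_mult)
  qed
  then have FA: "F \<in> A" by (rule A_if_Ck_on_UNIV)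
  have large: "real n \<le> \<bar>D F (p n)\<bar>" for n
  proof -
    \<comment> \<open>Near \<open>p n\<close> only the n-th summand of \<open>F\<close> is nonzero,
      so locality applies.\<close>
    have "D F (p n) = D (\<lambda>x. d n * \<phi> n x) (p n)"
    proof (rule D_local[OF FA])
      show "open {s (Suc n)<..<s n}" "p n \<in> {s (Suc n)<..<s n}" "p n \<in> I"
        using p pI by auto
      show "(\<lambda>x. d n * \<phi> n x) \<in> A" by (intro A_mult A_const A_if_Ck_on_UNIV \<phi>(1))
      fix x assume x: "x \<in> {s (Suc n)<..<s n}"
      have "\<phi> m x = 0" if "m \<noteq> n" for m
      proof (rule \<phi>(3))
        show "x \<le> s (Suc m) \<or> s m \<le> x"
          using x that s_anti[of "Suc m" n] s_anti[of "Suc n" m] by (cases "m < n") auto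
      qed
      then have "F x = (\<Sum>m\<in>{n}. d m * \<phi> m x)"
        unfolding F_def by (intro suminf_finite) auto
      then show "F x = d n * \<phi> n x" by simp
    qed
    also have "\<dots> = d n * D (\<phi> n) (p n) + \<phi> n (p n) * D (\<lambda>x. d n) (p n)"
      using D_mult[OF A_const A_if_Ck_on_UNIV[OF \<phi>(1)]] pI by simp
    finally have "\<bar>D F (p n)\<bar> \<ge> \<phi> n (p n) * \<bar>D (\<lambda>x. d n) (p n)\<bar> - \<bar>d n\<bar> * \<bar>D (\<phi> n) (p n)\<bar>"
      using \<phi>(2)[of n] by (simp add: abs_mult[symmetric] flip: abs_mult)
    moreover have "\<bar>d n\<bar> * \<bar>D (\<phi> n) (p n)\<bar> \<le> 1 * \<bar>D (\<phi> n) (p n)\<bar>"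
      using d(1)[of n] by (intro mult_right_mono) auto
    moreover have "\<phi> n (p n) * \<bar>D (\<lambda>x. d n) (p n)\<bar> \<ge> real n + \<bar>D (\<phi> n) (p n)\<bar>"
      using d(2)[of n] \<phi>(2)[of n] by (simp add: field_simps)
    ultimately show ?thesis by linarith
  qed
  \<comment> \<open>Continuity of \<open>D F\<close> at \<open>y\<close> contradicts its growth
    along \<open>p\<close>.\<close>
  have "(\<lambda>n. D F (p n)) \<longlonglongrightarrow> D F y"
    using isCont_D[OF FA y] p_lim by (rule isCont_tendsto_compose)
  then have "Bseq (\<lambda>n. D F (p n))" by (intro convergent_imp_Bseq convergentI)
  then obtain K where "\<And>n. \<bar>D F (p n)\<bar> \<le> K" by (auto simp: Bseq_def)
  with large have "real n \<le> K" for n using order_trans by blast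
  then show False using reals_Archimedean2[of K] by (meson not_less)
qed

section \<open>The form of a derivation, inside and at the endpoints\<close>

lemma D_eq_0_interior: "k = 0 \<Longrightarrow> f \<in> A \<Longrightarrow> y \<in> interior I \<Longrightarrow> D f y = 0"
  using D_eq_Taylor D_const by simp

text \<open>In the Taylor formula \<open>D_const\<close> removes the constant term, and in the
  linear term the product rule frees the factor \<open>deriv f y\<close> because
  \<open>x - y\<close> vanishes at \<open>y\<close>.\<close>

lemma D_eq_deriv_interior:
  assumes "k > 0" "f \<in> A" and y: "y \<in> interior I"
  shows "D f y = D (\<lambda>x. x) y * deriv f y"
proof -
  have yI: "y \<in> I" using y interior_subset by auto
  have "D (\<lambda>x. deriv f y * (x - y)) y = deriv f y * D (\<lambda>x. x - y) y"
    using D_mult[OF A_const[of "deriv f y"] A_shift[of y] yI] by simp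
  moreover have "D (\<lambda>x. x - y) y = D (\<lambda>x. x) y"
    using D_diff[OF A_ident A_const yI] D_const[OF y] by simp
  ultimately show ?thesis using D_eq_Taylor[OF assms(2) y] D_const[OF y] assms(1) by simp
qed

lemma zero_operator:
  assumes "k = 0"
  shows "zero_operator k I T"
  unfolding zero_operator_def
proof
  fix f assume f: "f \<in> Ck k I"
  have "D f x = 0" if "x \<in> I" for x
    by (rule eq_on_I_if_eq_on_interior[OF continuous_on_D[OF Ck_in_A[OF f]] continuous_on_const
        D_eq_0_interior[OF assms Ck_in_A[OF f]] that])
  then show "T f = (\<lambda>x\<in>I. 0)"
    using T_restrict[OF Ck_in_A[OF f]] f by (auto simp: Ck_def extensional_restrict)
qed

text \<open>At an end point of \<open>I\<close>, the mean value theorem provides interior points converging to it at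
  which \<open>deriv f\<close> converges to the one-sided derivative, although \<open>deriv f\<close> itself need not
  converge.\<close>

lemma D_eq_one_sided_derivative:
  assumes "k > 0" and f: "f \<in> A" and x: "x \<in> I" and E: "(f has_real_derivative E) (at x within I)"
  shows "D f x = D (\<lambda>x. x) x * E"
proof (cases "x \<in> interior I")
  case True
  then show ?thesis
    using E D_eq_deriv_interior[OF assms(1) f True] DERIV_imp_deriv at_within_interior by metis
next
  case False
  have conv: "convex I" using interval is_interval_convex by blast
  have "x \<in> closure (interior I)"
    using convex_closure_interior[OF conv interior] x closure_subset by auto
  then obtain z where z: "\<And>n. z n \<in> interior I" "z \<longlonglongrightarrow> x"
    by (auto simp: closure_sequential)
  note der = DERIV_A[OF assms(1) f]
  \<comment> \<open>Mean value theorem on the segment from \<open>x\<close> to \<open>z n\<close>.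
    Parametrising it by \<open>t\<close> treats left and right endpoints alike, and convexity puts
    all points with \<open>0 < t\<close> in the interior.\<close>
  have "\<exists>t. 0 < t \<and> t < 1 \<and> deriv f (x - t * (x - z n)) = (f (z n) - f x) / (z n - x)" for n
  proof -
    have seg: "x - t * (x - z n) \<in> interior I" if "0 < t" "t \<le> 1" for t
      using mem_interior_convex_shrink[OF conv z(1) x that] by simp
    have "x - t * (x - z n) \<in> I" if "t \<in> {0..1}" for t
      using seg[of t] that x interior_subset by (cases "t = 0") auto
    then have img: "(\<lambda>t. x - t * (x - z n)) ` {0..1} \<subseteq> I" by blast
    have "continuous_on {0..1} (\<lambda>t. f (x - t * (x - z n)))"
    proof (rule continuous_on_compose2[OF _ _ img])
      show "continuous_on I f" using f by (simp add: A_def)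
      show "continuous_on {0..1} (\<lambda>t. x - t * (x - z n))" by (intro continuous_intros)
    qed
    moreover have "((\<lambda>t. f (x - t * (x - z n))) has_real_derivative
        deriv f (x - t * (x - z n)) * (z n - x)) (at t)" if "0 < t" "t < 1" for t
    proof (rule DERIV_chain2[OF der])
      show "((\<lambda>t. x - t * (x - z n)) has_real_derivative z n - x) (at t)"
        by (auto intro!: derivative_eq_intros)
    qed (use seg that in auto)
    ultimately obtain t where t: "0 < t" "t < 1"
      "f (z n) - f x = deriv f (x - t * (x - z n)) * (z n - x)"
      using MVT[of 0 1 "\<lambda>t. f (x - t * (x - z n))"]
      by (force simp: real_differentiable_def dest: DERIV_unique)
    moreover have "z n \<noteq> x" using z(1) False by metis
    ultimately show ?thesis by (intro exI[of _ t]) simp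
  qed
  then obtain t where t: "\<And>n. 0 < t n" "\<And>n. t n < 1"
    "\<And>n. deriv f (x - t n * (x - z n)) = (f (z n) - f x) / (z n - x)" by metis
  define w where "w n = x - t n * (x - z n)" for n
  have wI: "w n \<in> interior I" for n
    using mem_interior_convex_shrink[OF conv z(1) x t(1), of n n] t(2)[of n] by (simp add: w_def)
  have "(\<lambda>n. t n * (x - z n)) \<longlonglongrightarrow> 0"
  proof (rule Lim_null_comparison)
    show "(\<lambda>n. \<bar>x - z n\<bar>) \<longlonglongrightarrow> 0"
      using tendsto_rabs[OF tendsto_diff[OF tendsto_const z(2), of x]] by simp
    show "\<forall>\<^sub>F n in sequentially. norm (t n * (x - z n)) \<le> \<bar>x - z n\<bar>"
      using t(1,2) by (auto simp: abs_mult less_imp_le mult_left_le_one_le)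
  qed
  then have w_lim: "w \<longlonglongrightarrow> x"
    unfolding w_def using tendsto_diff[OF tendsto_const, of _ 0 sequentially x] by simp
  have lim: "(\<lambda>n. D g (w n)) \<longlonglongrightarrow> D g x" if "g \<in> A" for g
    using continuous_on_tendsto_compose[OF continuous_on_D[OF that] w_lim x] wI interior_subset
    by (auto intro: always_eventually)
  \<comment> \<open>By the choice of \<open>t\<close> these are difference quotients of
    \<open>f\<close> at \<open>x\<close> along \<open>z\<close>, and \<open>z\<close> tends to
    \<open>x\<close> within \<open>I\<close> without meeting it.\<close>
  have "(\<lambda>n. deriv f (w n)) \<longlonglongrightarrow> E"
  proof -
    have "filterlim z (at x within I) sequentially"
      using z False interior_subset unfolding filterlim_at by (auto intro!: always_eventually)
    then show ?thesis
      using E filterlim_compose unfolding has_field_derivative_iff w_def t(3) by blast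
  qed
  from tendsto_mult[OF lim[OF A_ident] this] have "(\<lambda>n. D f (w n)) \<longlonglongrightarrow> D (\<lambda>x. x) x * E"
    using D_eq_deriv_interior[OF assms(1) f wI] by simp
  then show ?thesis using lim[OF f] LIMSEQ_unique by blast
qed

lemma multiple_of_derivative:
  assumes "k > 0"
  shows "multiple_of_derivative k I T"
  unfolding multiple_of_derivative_def
proof (intro bexI ballI allI impI)
  \<comment> \<open>The coefficient is the image of the identity.\<close>
  show "D (\<lambda>x. x) \<in> Ck 0 I"
    using additive restrict_in_Ck[OF A_ident] by (auto simp: D_def additive_operator_def)
  show "T f x = D (\<lambda>x. x) x * E"
    if "f \<in> Ck k I" "x \<in> I" "(f has_real_derivative E) (at x within I)" for f x E
    using D_eq_one_sided_derivative[OF assms Ck_in_A that(2,3)] that(1) by (simp add: D_Ck)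
qed

end

section \<open>Converse implications and conclusion\<close>

context additive_on_Ck
begin

lemma zero_imp_product_rule:
  assumes "zero_operator k I T"
  shows "product_rule (Ck k I) I T"
proof -
  have "D f y = 0" if "f \<in> A" "y \<in> I" for f y
    using assms restrict_in_Ck[OF that(1)] that(2) by (simp add: zero_operator_def D_def)
  then show ?thesis unfolding Ck_eq_image using product_rule_iff[of A] A_mult by auto
qed

text \<open>Leibniz' rule gives the identity at interior points. Endpoints, where \<open>f\<close>
  and \<open>g\<close> need not be differentiable, follow by continuity of both sides.\<close>

lemma multiple_of_derivative_imp_product_rule:
  assumes "k > 0" "multiple_of_derivative k I T"
  shows "product_rule (Ck k I) I T"
proof -
  obtain d where d: "\<And>f x E. f \<in> Ck k I \<Longrightarrow> x \<in> I \<Longrightarrow> (f has_real_derivative E) (at x within I)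
      \<Longrightarrow> T f x = d x * E"
    using assms(2) unfolding multiple_of_derivative_def by blast
  have D: "D f y = d y * E" if "f \<in> A" "y \<in> interior I" "(f has_real_derivative E) (at y)" for f y E
  proof -
    have "(restrict f I has_real_derivative E) (at y)"
      by (rule has_field_derivative_transform_within_open[OF that(3) open_interior that(2)])
         (use interior_subset[of I] in auto)
    then have "(restrict f I has_real_derivative E) (at y within I)"
      by (rule has_field_derivative_at_within)
    from d[OF restrict_in_Ck[OF that(1)] _ this] show ?thesis
      using that(2) interior_subset[of I] by (auto simp: D_def)
  qed
  have "D (\<lambda>x. f x * g x) y = f y * D g y + g y * D f y" if fg: "f \<in> A" "g \<in> A" and "y \<in> I" for f g y
  proof (rule eq_on_I_if_eq_on_interior[OF _ _ _ \<open>y \<in> I\<close>])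
    show "continuous_on I (D (\<lambda>x. f x * g x))" "continuous_on I (\<lambda>y. f y * D g y + g y * D f y)"
      using fg by (auto intro!: continuous_on_add continuous_on_mult continuous_on_D A_mult simp: A_cont)
    fix x assume x: "x \<in> interior I"
    note der = DERIV_A[OF assms(1) _ x]
    show "D (\<lambda>x. f x * g x) x = f x * D g x + g x * D f x"
      using D[OF A_mult[OF fg] x DERIV_mult[OF der[OF fg(1)] der[OF fg(2)]]]
        D[OF fg(1) x der[OF fg(1)]] D[OF fg(2) x der[OF fg(2)]]
      by (simp add: algebra_simps)
  qed
  then show ?thesis unfolding Ck_eq_image using product_rule_iff[of A] by auto
qed

lemma product_rule_iff_multiple_of_derivative:
  assumes "k > 0"
  shows "product_rule (Ck k I) I T \<longleftrightarrow> multiple_of_derivative k I T"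
proof
  assume "product_rule (Ck k I) I T"
  then interpret derivation_on_Ck by unfold_locales
  show "multiple_of_derivative k I T" using assms by (rule multiple_of_derivative)
qed (rule multiple_of_derivative_imp_product_rule[OF assms])

lemma product_rule_iff_zero_operator:
  assumes "k = 0"
  shows "product_rule (Ck k I) I T \<longleftrightarrow> zero_operator k I T"
proof
  assume "product_rule (Ck k I) I T"
  then interpret derivation_on_Ck by unfold_locales
  show "zero_operator k I T" using assms by (rule zero_operator)
qed (rule zero_imp_product_rule)

end

theorem corollary2:
  fixes k :: nat and I :: "real set" and T :: "(real \<Rightarrow> real) \<Rightarrow> real \<Rightarrow> real"
  assumes "is_interval I" and "interior I \<noteq> {}" and "additive_operator k I T"
  shows
   "(k > 0 \<longrightarrow>
       (square_rule (Ck k I) I T \<longleftrightarrow> multiple_of_derivative k I T) \<and>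
       (product_rule (Ck k I) I T \<longleftrightarrow> multiple_of_derivative k I T) \<and>
       (power_rule (Ck k I) I T \<longleftrightarrow> multiple_of_derivative k I T) \<and>
       (compact I \<longrightarrow>
         (product_rule (Ck_pos k I) I T \<longleftrightarrow> multiple_of_derivative k I T) \<and>
         (square_rule (Ck_pos k I) I T \<longleftrightarrow> multiple_of_derivative k I T) \<and>
         (reciprocal_rule (Ck_pos k I) I T \<longleftrightarrow> multiple_of_derivative k I T) \<and>
         (power_rule (Ck_pos k I) I T \<longleftrightarrow> multiple_of_derivative k I T))) \<and>
    (k = 0 \<longrightarrow>
       (square_rule (Ck k I) I T \<longleftrightarrow> zero_operator k I T) \<and>
       (product_rule (Ck k I) I T \<longleftrightarrow> zero_operator k I T) \<and>
       (power_rule (Ck k I) I T \<longleftrightarrow> zero_operator k I T) \<and>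
       (compact I \<longrightarrow>
         (product_rule (Ck_pos k I) I T \<longleftrightarrow> zero_operator k I T) \<and>
         (square_rule (Ck_pos k I) I T \<longleftrightarrow> zero_operator k I T) \<and>
         (reciprocal_rule (Ck_pos k I) I T \<longleftrightarrow> zero_operator k I T) \<and>
         (power_rule (Ck_pos k I) I T \<longleftrightarrow> zero_operator k I T)))"
proof -
  interpret additive_on_Ck k I T using assms by unfold_locales
  \<comment> \<open>Every rule is equivalent to the product rule on \<open>Ck k I\<close>, so its
    two characterisations, for \<open>k > 0\<close> and \<open>k = 0\<close>, suffice.\<close>
  show ?thesis
    using product_rule_iff_multiple_of_derivative product_rule_iff_zero_operator rules_equiv
    by blast
qed

end
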